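(* Let $\mathcal{K} = \{K_1,\dots,K_{d+1}\}$ be a separated family of $d+1$ nonempty compact convex sets in $\mathbb{R}^d$. Then the following statements are equivalent: (i) $\mathcal{K}$ is tight; (ii) $\Delta(\mathcal{K})$ is a nonempty open $d$-simplex; (iii) the set $\bigcap_{x_1\in K_1,\dots,x_{d+1}\in K_{d+1}} \operatorname{conv}(x_1,\dots,x_{d+1})$ has nonempty interior. Furthermore, if $\mathcal{K}$ is tight, then $$\overline{\Delta(\mathcal{K})} = \bigcap_{x_1\in K_1,\dots,x_{d+1}\in K_{d+1}} \operatorname{conv}(x_1,\dots,x_{d+1}).$$
   Context: A family of convex sets in $\mathbb{R}^d$ is separated if, for every $2\le k\le d+1$, no $k$ of its members can all be intersected by a single $(k-2)$-dimensional affine flat (for $d+1$ sets it suffices that no hyperplane meets all of them); otherwise a family of $d+1$ sets is crossed. A hyperplane $H$ is tangent to a convex set $K$ if $H\cap K\neq\emptyset$ and $K$ lies in one closed halfspace bounded by $H$; $H$ separates a family $\mathcal{A}$ from a family $\mathcal{B}$ if $\bigcup\mathcal{A}$ and $\bigcup\mathcal{B}$ lie in opposite closed halfspaces of $H$. For a separated family $\mathcal{K}=\{K_1,\dots,K_{d+1}\}$ of nonempty compact convex sets and each $i$, there is exactly one hyperplane $H_i$ that is tangent to every $K_j$, $j\neq i$, and separates $\{K_i\}$ from $\{K_j: j\neq i\}$ (the inner tangents of $\mathcal{K}$); orient it so that the open halfspace $H_i^-$ contains $K_i$ and $H_i^+ \supseteq \operatorname{conv}(\bigcup_{j\ne i}K_j)$.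 Set $\Delta(\mathcal{K}) := \bigcap_{i=1}^{d+1} H_i^-$. For a finite family $\mathcal{F}$ write $C(\mathcal{F}) := \operatorname{conv}(\bigcup_{K\in\mathcal{F}}K)$. The separated family $\mathcal{K}$ is tight if $\bigcap_{i=1}^{d+1} C(\mathcal{K}\setminus\{K_i\}) = \emptyset$, and loose otherwise. $\overline{A}$ denotes closure. *)

theory Defs
  imports "HOL-Analysis.Analysis"
begin

definition separated_family :: "'i set \<Rightarrow> ('i \<Rightarrow> 'a::euclidean_space set) \<Rightarrow> bool" where
  "separated_family I K \<longleftrightarrow>
     (\<forall>k\<in>{2..DIM('a) + 1}. \<forall>J. J \<subseteq> I \<and> card J = k \<longrightarrow>
        \<not> (\<exists>F. affine F \<and> aff_dim F = int k - 2 \<and> (\<forall>j\<in>J. F \<inter> K j \<noteq> {})))"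

text \<open>A hyperplane is a set \<open>{x. a \<bullet> x = b}\<close> with \<open>a \<noteq> 0\<close>. Since \<open>(a, b)\<close> may be
  replaced by \<open>(-a, -b)\<close>, it is enough to mention one of the two closed halfspaces below.\<close>

definition tangent_hyperplane :: "'a::euclidean_space set \<Rightarrow> 'a set \<Rightarrow> bool" where
  "tangent_hyperplane H S \<longleftrightarrow>
     H \<inter> S \<noteq> {} \<and> (\<exists>a b. a \<noteq> 0 \<and> H = {x. a \<bullet> x = b} \<and> S \<subseteq> {x. a \<bullet> x \<le> b})"

definition hyperplane_separates ::
    "'a::euclidean_space set \<Rightarrow> 'a set set \<Rightarrow> 'a set set \<Rightarrow> bool" where
  "hyperplane_separates H \<A> \<B> \<longleftrightarrow>
     (\<exists>a b. a \<noteq> 0 \<and> H = {x. a \<bullet> x = b} \<and>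
        \<Union>\<A> \<subseteq> {x. a \<bullet> x \<le> b} \<and> \<Union>\<B> \<subseteq> {x. a \<bullet> x \<ge> b})"

definition inner_tangent :: "'i set \<Rightarrow> ('i \<Rightarrow> 'a::euclidean_space set) \<Rightarrow> 'i \<Rightarrow> 'a set" where
  "inner_tangent I K i =
     (THE H. (\<forall>j\<in>I - {i}. tangent_hyperplane H (K j)) \<and>
             hyperplane_separates H {K i} (K ` (I - {i})))"

definition family_hull :: "'a::euclidean_space set set \<Rightarrow> 'a set" where
  "family_hull \<F> = convex hull (\<Union>\<F>)"

text \<open>The open halfspace \<open>H\<^sub>i\<^sup>-\<close>. Its opposite \<open>H\<^sub>i\<^sup>+\<close> is the closed
  halfspace, because the inner tangent touches each of the remaining sets.\<close>

definition inner_halfspace :: "'i set \<Rightarrow> ('i \<Rightarrow> 'a::euclidean_space set) \<Rightarrow> 'i \<Rightarrow> 'a set" where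
  "inner_halfspace I K i =
     (THE S. \<exists>a b. a \<noteq> 0 \<and> inner_tangent I K i = {x. a \<bullet> x = b} \<and> S = {x. a \<bullet> x < b} \<and>
        K i \<subseteq> S \<and> family_hull (K ` (I - {i})) \<subseteq> {x. a \<bullet> x \<ge> b})"

definition Delta :: "'i set \<Rightarrow> ('i \<Rightarrow> 'a::euclidean_space set) \<Rightarrow> 'a set" where
  "Delta I K = (\<Inter>i\<in>I. inner_halfspace I K i)"

definition tight :: "'i set \<Rightarrow> ('i \<Rightarrow> 'a::euclidean_space set) \<Rightarrow> bool" where
  "tight I K \<longleftrightarrow> (\<Inter>i\<in>I. family_hull (K ` (I - {i}))) = {}"

definition open_simplex :: "int \<Rightarrow> 'a::euclidean_space set \<Rightarrow> bool" where
  "open_simplex n U \<longleftrightarrow> (\<exists>S. n simplex S \<and> U = rel_interior S)"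

definition simplex_intersection ::
    "'i set \<Rightarrow> ('i \<Rightarrow> 'a::euclidean_space set) \<Rightarrow> 'a set" where
  "simplex_intersection I K = (\<Inter>x\<in>(\<Pi> i\<in>I. K i). convex hull (x ` I))"

end

theory Submission
  imports Defs
begin

text \<open>A point \<open>x\<close> is lifted to \<open>(x, 1)\<close>, so that affine functions become vectors \<open>w\<close> acting by
  \<open>w \<bullet> (x, 1)\<close>; separation says that every transversal of the lifted bodies is a basis.

  The inner tangents are obtained as vectors \<open>u i\<close> with prescribed support values on the lifted
  bodies. For every transversal \<open>x\<close> the matrix \<open>u i \<bullet> (x j, 1)\<close> has positive diagonal and nonpositive
  off-diagonal entries, and all three conditions amount to its being a nonsingular M-matrix,
  equivalently to the constant function \<open>1\<close> being a nonnegative combination of the \<open>u i\<close>. Given such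
  a combination, the coordinates with respect to \<open>x\<close> of a point with all \<open>u i\<close> nonnegative are
  nonnegative, so the closed simplex cut out by the \<open>u i\<close> lies in every \<open>conv(x)\<close>.

  If the family is tight, the hulls have empty intersection, so some nonnegative combination of affine
  functions \<open>v i\<close>, nonpositive on the respective hulls, is constantly \<open>1\<close>. The \<open>v i\<close> need not be tangent,
  but by the same M-matrix argument they cut out a simplex inside every \<open>conv(x)\<close>; an interior point of
  it has all \<open>u i\<close> positive, which makes the matrix of the \<open>u i\<close> an M-matrix too.\<close>

section \<open>Dual bases\<close>

text \<open>Independence makes the map from \<open>z\<close> to the values
  \<open>u i \<bullet> z\<close> injective, hence bijective by the dimension count; the dual vectors
  are the preimages of the unit vectors. Applied both to lifted transversals and to families of
  affine functions.\<close>

lemma dual_family: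
  fixes u :: "'i \<Rightarrow> 'b::euclidean_space"
  assumes card: "card I = DIM('b)"
    and indep: "\<And>w. (\<And>i. i \<in> I \<Longrightarrow> u i \<bullet> w = 0) \<Longrightarrow> w = 0"
  obtains w where "\<And>i k. i \<in> I \<Longrightarrow> k \<in> I \<Longrightarrow> u i \<bullet> w k = (if i = k then 1 else 0)"
    and "\<And>z. z = (\<Sum>k\<in>I. (u k \<bullet> z) *\<^sub>R w k)"
    and "\<And>z. z = (\<Sum>k\<in>I. (w k \<bullet> z) *\<^sub>R u k)"
proof -
  have fin: "finite I" using card card.infinite by fastforce
  obtain e where e: "bij_betw e I (Basis :: 'b set)"
    using fin card finite_same_card_bij[of I "Basis :: 'b set"] by auto
  have ee: "e i \<bullet> e k = (if i = k then 1 else 0)" if "i \<in> I" "k \<in> I" for i k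
    using e that by (metis bij_betwE bij_betw_inv_into_left inner_Basis)
  define \<Phi> where "\<Phi> z = (\<Sum>i\<in>I. (u i \<bullet> z) *\<^sub>R e i)" for z
  have \<Phi>e: "\<Phi> z \<bullet> e k = u k \<bullet> z" if "k \<in> I" for z k
  proof -
    have "\<Phi> z \<bullet> e k = (\<Sum>i\<in>I. if i = k then u i \<bullet> z else 0)"
      unfolding \<Phi>_def inner_sum_left by (rule sum.cong) (use that ee in auto)
    then show ?thesis using fin that by simp
  qed
  have lin: "linear \<Phi>"
    unfolding \<Phi>_def
    by (rule linearI) (simp_all add: inner_add_right scaleR_add_left sum.distrib scaleR_sum_right)
  have inj: "inj \<Phi>"
    unfolding linear_injective_0[OF lin]
  proof (intro allI impI)
    fix z assume "\<Phi> z = 0"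
    then show "z = 0" using \<Phi>e[of _ z] by (intro indep) simp
  qed
  have surj: "surj \<Phi>" using linear_injective_imp_surjective[OF lin inj] by simp
  define w where "w k = inv \<Phi> (e k)" for k
  have w: "\<Phi> (w k) = e k" for k by (simp add: w_def surj_f_inv_f[OF surj])
  have dual: "u i \<bullet> w k = (if i = k then 1 else 0)" if "i \<in> I" "k \<in> I" for i k
    using \<Phi>e[OF that(1), of "w k"] ee[OF that(2,1)] by (auto simp: w)
  have exp: "z = (\<Sum>k\<in>I. (u k \<bullet> z) *\<^sub>R w k)" for z
  proof -
    have "\<Phi> (\<Sum>k\<in>I. (u k \<bullet> z) *\<^sub>R w k) = \<Phi> z"
      by (simp add: linear_sum[OF lin] linear_cmul[OF lin] w) (simp add: \<Phi>_def)
    from injD[OF inj this] show ?thesis by (rule sym)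
  qed
  \<comment> \<open>The transpose of \<open>exp\<close>: pair with an arbitrary \<open>y\<close> and
    expand \<open>y\<close>.\<close>
  have "z = (\<Sum>k\<in>I. (w k \<bullet> z) *\<^sub>R u k)" for z
  proof (rule vector_eq_rdot[THEN iffD1], intro allI)
    fix y
    have "z \<bullet> y = z \<bullet> (\<Sum>k\<in>I. (u k \<bullet> y) *\<^sub>R w k)" by (rule arg_cong[OF exp])
    also have "\<dots> = (\<Sum>k\<in>I. (w k \<bullet> z) *\<^sub>R u k) \<bullet> y"
      by (simp add: inner_sum_right inner_sum_left inner_commute mult.commute)
    finally show "z \<bullet> y = (\<Sum>k\<in>I. (w k \<bullet> z) *\<^sub>R u k) \<bullet> y" .
  qed
  with dual exp show ?thesis by (rule that)
qed

section \<open>Support values of compact convex sets\<close>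

text \<open>Attainment is part of the relation, so that support value \<open>0\<close> on a lifted
  body expresses tangency.\<close>

definition has_support :: "'b::real_inner \<Rightarrow> 'b set \<Rightarrow> real \<Rightarrow> bool" where
  "has_support u S v \<longleftrightarrow> (\<forall>y\<in>S. u \<bullet> y \<le> v) \<and> (\<exists>y\<in>S. u \<bullet> y = v)"

lemma has_support_unique: "has_support u S v \<Longrightarrow> has_support u S v' \<Longrightarrow> v = v'"
  unfolding has_support_def by (metis order_antisym)

lemma has_support_scaleR:
  "0 \<le> t \<Longrightarrow> has_support u S v \<Longrightarrow> has_support (t *\<^sub>R u) S (t * v)"
  unfolding has_support_def by (auto intro: mult_left_mono)

lemma has_support_exists:
  assumes "compact S" "S \<noteq> {}"
  shows "\<exists>v. has_support u S v"
proof -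
  have "continuous_on S (\<lambda>y. u \<bullet> y)" by (intro continuous_intros)
  from continuous_attains_sup[OF assms this] show ?thesis
    unfolding has_support_def by blast
qed

text \<open>Between a maximiser of \<open>u\<close> and one of \<open>u'\<close> the difference \<open>u - u'\<close> changes sign, so
  it vanishes on a transversal of the family.\<close>

lemma support_values_inject:
  fixes L :: "'i \<Rightarrow> 'b::real_inner set"
  assumes conv: "\<And>j. j \<in> I \<Longrightarrow> convex (L j)"
    and indep: "\<And>x w. x \<in> Pi I L \<Longrightarrow> (\<And>j. j \<in> I \<Longrightarrow> x j \<bullet> w = 0) \<Longrightarrow> w = 0"
    and u: "\<And>j. j \<in> I \<Longrightarrow> has_support u (L j) (v j)"
    and u': "\<And>j. j \<in> I \<Longrightarrow> has_support u' (L j) (v j)"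
  shows "u = u'"
proof -
  have "\<exists>z\<in>L j. z \<bullet> (u - u') = 0" if j: "j \<in> I" for j
  proof -
    obtain y y' where y: "y \<in> L j" "u \<bullet> y = v j" and y': "y' \<in> L j" "u' \<bullet> y' = v j"
      using u[OF j] u'[OF j] unfolding has_support_def by blast
    have "connected (L j)" using conv[OF j] by (rule convex_connected)
    moreover have "(u - u') \<bullet> y' \<le> 0" "0 \<le> (u - u') \<bullet> y"
      using u[OF j] u'[OF j] y y' unfolding has_support_def by (auto simp: inner_diff_left)
    ultimately obtain z where "z \<in> L j" "(u - u') \<bullet> z = 0"
      using connected_ivt_hyperplane[of "L j" y' y "u - u'" 0] y y' by blast
    then show ?thesis by (metis inner_commute)
  qed
  then obtain z where "\<And>j. j \<in> I \<Longrightarrow> z j \<in> L j \<and> z j \<bullet> (u - u') = 0" by metis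
  then have "u - u' = 0" by (intro indep[of z]) auto
  then show ?thesis by simp
qed

text \<open>The map sending \<open>u\<close> to its support values is continuous, injective and positively
  homogeneous; invariance of domain makes its image a neighbourhood of the origin, and
  homogeneity then makes it everything.\<close>

lemma support_values_surject:
  fixes L :: "'i \<Rightarrow> 'b::euclidean_space set"
  assumes card: "card I = DIM('b)"
    and ne: "\<And>j. j \<in> I \<Longrightarrow> L j \<noteq> {}"
    and comp: "\<And>j. j \<in> I \<Longrightarrow> compact (L j)"
    and conv: "\<And>j. j \<in> I \<Longrightarrow> convex (L j)"
    and indep: "\<And>x w. x \<in> Pi I L \<Longrightarrow> (\<And>j. j \<in> I \<Longrightarrow> x j \<bullet> w = 0) \<Longrightarrow> w = 0"
  shows "\<exists>u. \<forall>j\<in>I. has_support u (L j) (v j)"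
proof -
  have fin: "finite I" using card card.infinite by fastforce
  obtain e where e: "bij_betw e I (Basis :: 'b set)"
    using fin card finite_same_card_bij[of I "Basis :: 'b set"] by auto
  have ee: "e i \<bullet> e k = (if i = k then 1 else 0)" if "i \<in> I" "k \<in> I" for i k
    using e that by (metis bij_betwE bij_betw_inv_into_left inner_Basis)
  have "\<exists>v. has_support u (L j) v" if "j \<in> I" for u j
    by (rule has_support_exists[OF comp[OF that] ne[OF that]])
  then obtain \<sigma> where \<sigma>: "\<And>j u. j \<in> I \<Longrightarrow> has_support u (L j) (\<sigma> j u)" by metis
  \<comment> \<open>Storing the support values along the basis \<open>e\<close> makes
    \<open>F\<close> a self-map of \<open>'b\<close>, as invariance of domain requires.\<close>
  define F where "F u = (\<Sum>j\<in>I. \<sigma> j u *\<^sub>R e j)" for u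
  have coord: "(\<Sum>j\<in>I. c j *\<^sub>R e j) \<bullet> e k = c k" if "k \<in> I" for c k
  proof -
    have "(\<Sum>j\<in>I. c j *\<^sub>R e j) \<bullet> e k = (\<Sum>j\<in>I. if j = k then c j else 0)"
      unfolding inner_sum_left by (rule sum.cong) (use that ee in auto)
    then show ?thesis using fin that by simp
  qed
  \<comment> \<open>A support function is convex, being a maximum of linear functions, and a finite
    convex function on the whole space is continuous.\<close>
  have "continuous_on UNIV (\<sigma> j)" if j: "j \<in> I" for j
  proof (rule convex_on_continuous)
    show "convex_on UNIV (\<sigma> j)"
    proof (rule convex_onI)
      fix t :: real and x y assume t: "0 < t" "t < 1"
      obtain z where z: "z \<in> L j" "((1 - t) *\<^sub>R x + t *\<^sub>R y) \<bullet> z = \<sigma> j ((1 - t) *\<^sub>R x + t *\<^sub>R y)"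
        using \<sigma>[OF j] unfolding has_support_def by blast
      have "x \<bullet> z \<le> \<sigma> j x" "y \<bullet> z \<le> \<sigma> j y"
        using \<sigma>[OF j] z unfolding has_support_def by auto
      then have "(1 - t) * (x \<bullet> z) + t * (y \<bullet> z) \<le> (1 - t) * \<sigma> j x + t * \<sigma> j y"
        using t by (intro add_mono mult_left_mono) auto
      then show "\<sigma> j ((1 - t) *\<^sub>R x + t *\<^sub>R y) \<le> (1 - t) * \<sigma> j x + t * \<sigma> j y"
        using z by (simp add: inner_add_left)
    qed simp
  qed simp
  then have contF: "continuous_on UNIV F"
    unfolding F_def by (intro continuous_intros) auto
  have injF: "inj F"
  proof (rule injI)
    fix u u' assume "F u = F u'"
    then have "\<sigma> j u = \<sigma> j u'" if "j \<in> I" for j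
      unfolding F_def using coord that by metis
    then have "has_support u' (L j) (\<sigma> j u)" if "j \<in> I" for j
      using \<sigma>[OF that, of u'] that by simp
    with conv indep \<sigma>[of _ u] show "u = u'"
      by (rule support_values_inject)
  qed
  have "open (range F)"
    using invariance_of_domain[OF contF open_UNIV injF] .
  moreover have "F 0 = 0"
  proof -
    have "has_support 0 (L j) 0" if "j \<in> I" for j
      using ne[OF that] by (auto simp: has_support_def)
    then have "\<sigma> j 0 = 0" if "j \<in> I" for j
      using has_support_unique \<sigma> that by metis
    then show ?thesis by (simp add: F_def)
  qed
  ultimately obtain \<epsilon> where \<epsilon>: "\<epsilon> > 0" "ball 0 \<epsilon> \<subseteq> range F"
    by (metis openE rangeI)
  define V where "V = (\<Sum>j\<in>I. v j *\<^sub>R e j)"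
  \<comment> \<open>Scales \<open>V\<close> into the ball around \<open>0\<close>; the
    \<open>+ 1\<close> covers \<open>V = 0\<close>.\<close>
  define t where "t = \<epsilon> / (norm V + 1)"
  have t: "t > 0" using \<epsilon> by (simp add: t_def add_nonneg_pos)
  have "norm (t *\<^sub>R V) = \<epsilon> * (norm V / (norm V + 1))" using \<epsilon>(1) by (simp add: t_def)
  also have "\<dots> < \<epsilon> * 1"
    using \<epsilon>(1) by (intro mult_strict_left_mono) (auto simp: divide_less_eq add_nonneg_pos)
  finally have "t *\<^sub>R V \<in> range F" using \<epsilon>(2) by auto
  then obtain u where u: "F u = t *\<^sub>R V" by auto
  have "has_support ((1/t) *\<^sub>R u) (L j) (v j)" if j: "j \<in> I" for j
  proof -
    have "\<sigma> j u = t * v j"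
      using coord[OF j, of v] coord[OF j, of "\<lambda>j. \<sigma> j u"] u
      unfolding V_def F_def by simp
    then show ?thesis
      using has_support_scaleR[of "1/t" u "L j" "\<sigma> j u"] \<sigma>[OF j, of u] t by simp
  qed
  then show ?thesis by blast
qed

section \<open>Matrices with nonpositive off-diagonal entries\<close>

text \<open>Keep only the rows in the set \<open>J\<close> of indices where \<alpha> is negative. In
  a column of \<open>J\<close> the discarded entries are off-diagonal, so the weighted sum stays
  positive; in any other column all kept entries are off-diagonal, so it is nonpositive. Weighted by
  \<alpha>, every column contributes at most zero and those in \<open>J\<close> strictly less,
  although the total is a nonnegative combination of entries of \<open>A \<alpha>\<close>.\<close>

lemma Z_matrix_nonneg_of_positive_row_combination:
  fixes A :: "'i \<Rightarrow> 'i \<Rightarrow> real"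
  assumes fin: "finite I"
    and off: "\<And>i j. i \<in> I \<Longrightarrow> j \<in> I \<Longrightarrow> i \<noteq> j \<Longrightarrow> A i j \<le> 0"
    and c: "\<And>i. i \<in> I \<Longrightarrow> 0 \<le> c i"
    and cA: "\<And>j. j \<in> I \<Longrightarrow> 0 < (\<Sum>i\<in>I. c i * A i j)"
    and \<alpha>: "\<And>i. i \<in> I \<Longrightarrow> 0 \<le> (\<Sum>j\<in>I. A i j * \<alpha> j)"
    and j: "j \<in> I"
  shows "0 \<le> \<alpha> j"
proof (rule ccontr)
  assume neg: "\<not> 0 \<le> \<alpha> j"
  define J where "J = {j\<in>I. \<alpha> j < 0}"
  have J: "J \<subseteq> I" "finite J" using fin by (auto simp: J_def)
  have s: "(\<Sum>i\<in>J. c i * A i k) * \<alpha> k \<le> 0 \<and> (k \<in> J \<longrightarrow> (\<Sum>i\<in>J. c i * A i k) * \<alpha> k < 0)"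
    if k: "k \<in> I" for k
  proof (cases "k \<in> J")
    case True
    have "(\<Sum>i\<in>I. c i * A i k) = (\<Sum>i\<in>J. c i * A i k) + (\<Sum>i\<in>I - J. c i * A i k)"
      using J fin by (metis add.commute sum.subset_diff)
    moreover have "(\<Sum>i\<in>I - J. c i * A i k) \<le> 0"
      using off c k True by (intro sum_nonpos mult_nonneg_nonpos) auto
    ultimately have "0 < (\<Sum>i\<in>J. c i * A i k)" using cA[OF k] by linarith
    moreover have "\<alpha> k < 0" using True by (simp add: J_def)
    ultimately have "(\<Sum>i\<in>J. c i * A i k) * \<alpha> k < 0" by (rule mult_pos_neg)
    then show ?thesis by simp
  next
    case False
    have "(\<Sum>i\<in>J. c i * A i k) \<le> 0"
      using off c k False J by (intro sum_nonpos mult_nonneg_nonpos) auto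
    moreover have "0 \<le> \<alpha> k" using False k by (simp add: J_def)
    ultimately show ?thesis using False by (simp add: mult_nonpos_nonneg)
  qed
  have "0 \<le> (\<Sum>i\<in>J. c i * (\<Sum>k\<in>I. A i k * \<alpha> k))"
    using J by (intro sum_nonneg[OF mult_nonneg_nonneg[OF c \<alpha>]]) auto
  also have "\<dots> = (\<Sum>k\<in>I. (\<Sum>i\<in>J. c i * A i k) * \<alpha> k)"
    by (simp add: sum_distrib_left sum_distrib_right mult.assoc) (rule sum.swap)
  also have "\<dots> < (\<Sum>k\<in>I. 0)"
  proof (rule sum_strict_mono_ex1[OF fin])
    have "j \<in> J" using neg j by (simp add: J_def)
    then show "\<exists>k\<in>I. (\<Sum>i\<in>J. c i * A i k) * \<alpha> k < 0" using s[OF j] j by blast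
  qed (use s in blast)
  finally show False by simp
qed

text \<open>Once \<alpha> is known to be positive, take the least multiple \<open>m \<alpha>\<close>
  that dominates \<mu>. Equality holds at some \<open>k\<close>, so row \<open>k\<close> meets the
  nonnegative vector \<open>m \<alpha> - \<mu>\<close> only off the diagonal and gives a nonpositive
  value. If \<mu> had a positive entry then \<open>m > 0\<close>, and that value would be
  positive.\<close>

lemma Z_matrix_nonpos_of_positive_image:
  fixes A :: "'i \<Rightarrow> 'i \<Rightarrow> real"
  assumes fin: "finite I"
    and off: "\<And>i j. i \<in> I \<Longrightarrow> j \<in> I \<Longrightarrow> i \<noteq> j \<Longrightarrow> A i j \<le> 0"
    and diag: "\<And>i. i \<in> I \<Longrightarrow> 0 < A i i"
    and \<alpha>: "\<And>i. i \<in> I \<Longrightarrow> 0 \<le> \<alpha> i"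
    and A\<alpha>: "\<And>i. i \<in> I \<Longrightarrow> 0 < (\<Sum>j\<in>I. A i j * \<alpha> j)"
    and \<mu>: "\<And>i. i \<in> I \<Longrightarrow> (\<Sum>j\<in>I. A i j * \<mu> j) \<le> 0"
    and j: "j \<in> I"
  shows "\<mu> j \<le> 0"
proof (rule ccontr)
  assume pos: "\<not> \<mu> j \<le> 0"
  have split: "(\<Sum>j\<in>I. A i j * f j) = A i i * f i + (\<Sum>j\<in>I - {i}. A i j * f j)"
    if "i \<in> I" for i and f :: "'i \<Rightarrow> real"
    using fin that by (simp add: sum.remove)
  have \<alpha>pos: "0 < \<alpha> i" if i: "i \<in> I" for i
  proof -
    have "(\<Sum>j\<in>I - {i}. A i j * \<alpha> j) \<le> 0"
      using off \<alpha> i by (intro sum_nonpos mult_nonpos_nonneg) auto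
    then have "0 < A i i * \<alpha> i" using A\<alpha>[OF i] split[OF i, of \<alpha>] by linarith
    then show ?thesis using diag[OF i] by (simp add: zero_less_mult_iff)
  qed
  define m where "m = Max ((\<lambda>k. \<mu> k / \<alpha> k) ` I)"
  obtain k where k: "k \<in> I" "m = \<mu> k / \<alpha> k"
    using Max_in[of "(\<lambda>k. \<mu> k / \<alpha> k) ` I"] fin j unfolding m_def by blast
  have le: "\<mu> i / \<alpha> i \<le> m" if "i \<in> I" for i
    unfolding m_def using fin that by (intro Max_ge) auto
  have le': "\<mu> i \<le> m * \<alpha> i" if "i \<in> I" for i
    using le[OF that] \<alpha>pos[OF that] by (simp add: divide_le_eq)
  have "0 < m" using le[OF j] \<alpha>pos[OF j] pos
    by (meson divide_pos_pos less_le_trans not_le)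
  have "(\<Sum>i\<in>I - {k}. A k i * (m * \<alpha> i - \<mu> i)) \<le> 0"
    using off k le' by (intro sum_nonpos mult_nonpos_nonneg) auto
  moreover have "m * \<alpha> k - \<mu> k = 0" using k \<alpha>pos[of k] by simp
  ultimately have "(\<Sum>i\<in>I. A k i * (m * \<alpha> i - \<mu> i)) \<le> 0"
    using split[of k "\<lambda>i. m * \<alpha> i - \<mu> i"] k by simp
  moreover have "(\<Sum>i\<in>I. A k i * (m * \<alpha> i - \<mu> i)) = m * (\<Sum>i\<in>I. A k i * \<alpha> i) - (\<Sum>i\<in>I. A k i * \<mu> i)"
    by (simp add: algebra_simps sum_subtractf sum_distrib_left)
  ultimately show False
    using \<mu>[OF k(1)] mult_pos_pos[OF \<open>0 < m\<close> A\<alpha>[OF k(1)]] by linarith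
qed

section \<open>Certificates for empty intersections\<close>

text \<open>The certificate is the gradient of the sum of squared distances to the sets, taken at a
  minimiser.\<close>

lemma empty_Inter_certificate:
  fixes C :: "'i \<Rightarrow> 'a::euclidean_space set"
  assumes fin: "finite I"
    and comp: "\<And>i. i \<in> I \<Longrightarrow> compact (C i)"
    and conv: "\<And>i. i \<in> I \<Longrightarrow> convex (C i)"
    and ne: "\<And>i. i \<in> I \<Longrightarrow> C i \<noteq> {}"
    and emp: "(\<Inter>i\<in>I. C i) = {}"
  shows "\<exists>f. (\<forall>i\<in>I. \<forall>y\<in>C i. f i \<bullet> (y, 1::real) \<le> 0) \<and> (\<Sum>i\<in>I. f i) = (0, 1)"
proof -
  have Ine: "I \<noteq> {}" using emp by auto
  define n where "n = real (card I)"
  have n: "n > 0" using fin Ine by (simp add: n_def card_gt_0_iff)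
  have closed: "closed (C i)" if "i \<in> I" for i using comp[OF that] by (rule compact_imp_closed)
  have "bounded (\<Union>i\<in>I. C i)" using fin comp compact_imp_bounded by blast
  then obtain R where R: "\<And>i y. i \<in> I \<Longrightarrow> y \<in> C i \<Longrightarrow> norm y \<le> R"
    unfolding bounded_iff by blast
  have R0: "0 \<le> R" using Ine ne R by (metis all_not_in_conv norm_ge_zero order_trans)
  define g where "g x = (\<Sum>i\<in>I. (norm (x - closest_point (C i) x))\<^sup>2)" for x
  have "continuous_on (cball 0 R) g"
    unfolding g_def
    by (intro continuous_intros continuous_on_closest_point conv closed ne) auto
  then obtain x0 where x0: "x0 \<in> cball 0 R" "\<And>x. x \<in> cball 0 R \<Longrightarrow> g x0 \<le> g x"
    using continuous_attains_inf[of "cball (0::'a) R" g] R0 by auto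
  define \<pi> where "\<pi> i = closest_point (C i) x0" for i
  have \<pi>: "\<pi> i \<in> C i" if "i \<in> I" for i
    unfolding \<pi>_def using closest_point_in_set[OF closed[OF that] ne[OF that]] .
  define s where "s = (\<Sum>i\<in>I. x0 - \<pi> i)"
  \<comment> \<open>A gradient step that lands on the mean of the points \<open>\<pi> i\<close>,
    hence inside the ball over which \<open>x0\<close> is minimal.\<close>
  define x' where "x' = x0 - (1/n) *\<^sub>R s"
  have "s = n *\<^sub>R x0 - (\<Sum>i\<in>I. \<pi> i)"
    unfolding s_def n_def by (simp add: sum_subtractf scaleR_conv_of_real sum_constant_scaleR)
  then have x'eq: "x' = (1/n) *\<^sub>R (\<Sum>i\<in>I. \<pi> i)"
    unfolding x'_def using n by (simp add: scaleR_diff_right)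
  have "norm (\<Sum>i\<in>I. \<pi> i) \<le> (\<Sum>i\<in>I. R)"
    using \<pi> R by (intro sum_norm_le) auto
  then have "norm x' \<le> R"
    unfolding x'eq using n by (simp add: n_def field_simps)
  then have "g x0 \<le> g x'" by (intro x0) simp
  \<comment> \<open>Keeping the projections of \<open>x0\<close> instead of those of
    \<open>x'\<close> can only increase the distances, and leaves a quadratic in \<open>s\<close>
    that forces \<open>s = 0\<close>.\<close>
  also have "g x' \<le> (\<Sum>i\<in>I. (norm (x' - \<pi> i))\<^sup>2)"
    unfolding g_def using closest_point_le[OF closed \<pi>, of _ x']
    by (intro sum_mono power_mono) (auto simp: dist_norm)
  also have "\<dots> = (\<Sum>i\<in>I. (norm (x0 - \<pi> i))\<^sup>2 - 2 / n * ((x0 - \<pi> i) \<bullet> s) + (norm s)\<^sup>2 / n\<^sup>2)"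
  proof (rule sum.cong[OF refl])
    fix i
    have expand: "(norm (d - (1/n) *\<^sub>R s))\<^sup>2 = (norm d)\<^sup>2 - 2 / n * (d \<bullet> s) + (norm s)\<^sup>2 / n\<^sup>2" for d
      unfolding power2_norm_eq_inner
      by (simp add: inner_diff_left inner_diff_right inner_commute power2_eq_square field_simps)
    have "x' - \<pi> i = (x0 - \<pi> i) - (1/n) *\<^sub>R s" by (simp add: x'_def)
    then show "(norm (x' - \<pi> i))\<^sup>2
        = (norm (x0 - \<pi> i))\<^sup>2 - 2 / n * ((x0 - \<pi> i) \<bullet> s) + (norm s)\<^sup>2 / n\<^sup>2"
      by (simp only: expand)
  qed
  also have "\<dots> = g x0 - 2 / n * (s \<bullet> s) + n * ((norm s)\<^sup>2 / n\<^sup>2)"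
  proof -
    have "(\<Sum>i\<in>I. (x0 - \<pi> i) \<bullet> s) = s \<bullet> s"
      unfolding s_def by (rule inner_sum_left[symmetric])
    then have "(\<Sum>i\<in>I. 2 / n * ((x0 - \<pi> i) \<bullet> s)) = 2 / n * (s \<bullet> s)"
      by (simp only: sum_distrib_left[symmetric])
    then show ?thesis
      unfolding sum.distrib sum_subtractf by (simp add: g_def \<pi>_def n_def)
  qed
  also have "\<dots> = g x0 - (norm s)\<^sup>2 / n"
    using n by (simp add: dot_square_norm power2_eq_square field_simps)
  finally have "(norm s)\<^sup>2 / n \<le> 0" by simp
  then have s0: "s = 0" using n by (simp add: divide_le_0_iff)
  define r where "r = (\<Sum>i\<in>I. (x0 - \<pi> i) \<bullet> (x0 - \<pi> i))"
  have "r \<noteq> 0"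
  proof
    assume "r = 0"
    then have "x0 = \<pi> i" if "i \<in> I" for i
      using that fin by (simp add: r_def sum_nonneg_eq_0_iff)
    then have "x0 \<in> (\<Inter>i\<in>I. C i)" using \<pi> by auto
    then show False using emp by simp
  qed
  moreover have "r \<ge> 0" unfolding r_def by (intro sum_nonneg) simp
  ultimately have r: "r > 0" by simp
  \<comment> \<open>Up to the factor, \<open>f i\<close> is the affine function
    \<open>(x0 - \<pi> i) \<bullet> (y - \<pi> i)\<close> of \<open>y\<close>, nonpositive on
    \<open>C i\<close> by the projection inequality. In the sum the linear parts cancel because
    \<open>s = 0\<close> and the constants add up to \<open>r\<close>, hence
    \<open>1/r\<close>.\<close>
  define f where "f i = (1/r) *\<^sub>R (x0 - \<pi> i, - ((x0 - \<pi> i) \<bullet> \<pi> i))" for i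
  have "f i \<bullet> (y, 1) \<le> 0" if "i \<in> I" "y \<in> C i" for i y
  proof -
    have "(x0 - \<pi> i) \<bullet> (y - \<pi> i) \<le> 0"
      unfolding \<pi>_def using closest_point_dot[OF conv closed] that by blast
    then have "(1/r) * ((x0 - \<pi> i) \<bullet> (y - \<pi> i)) \<le> 0"
      using r by (intro mult_nonneg_nonpos) auto
    then show ?thesis by (simp add: f_def inner_diff_right right_diff_distrib)
  qed
  moreover have "(\<Sum>i\<in>I. f i) = (0, 1)"
  proof -
    have "(\<Sum>i\<in>I. (x0 - \<pi> i) \<bullet> \<pi> i) = (\<Sum>i\<in>I. (x0 - \<pi> i) \<bullet> x0 - (x0 - \<pi> i) \<bullet> (x0 - \<pi> i))"
      by (rule sum.cong) (simp_all add: inner_diff_right)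
    also have "\<dots> = (\<Sum>i\<in>I. (x0 - \<pi> i) \<bullet> x0) - r" by (simp only: sum_subtractf r_def)
    also have "(\<Sum>i\<in>I. (x0 - \<pi> i) \<bullet> x0) = s \<bullet> x0"
      unfolding s_def by (rule inner_sum_left[symmetric])
    finally have "(\<Sum>i\<in>I. (x0 - \<pi> i) \<bullet> \<pi> i) = - r" using s0 by simp
    then have "(\<Sum>i\<in>I. (x0 - \<pi> i, - ((x0 - \<pi> i) \<bullet> \<pi> i))) = (0, r)"
      using s0 by (simp add: prod_eq_iff fst_sum snd_sum s_def sum_negf)
    moreover have "(\<Sum>i\<in>I. f i) = (1/r) *\<^sub>R (\<Sum>i\<in>I. (x0 - \<pi> i, - ((x0 - \<pi> i) \<bullet> \<pi> i)))"
      unfolding f_def by (rule scaleR_sum_right[symmetric])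
    ultimately show ?thesis using r by simp
  qed
  ultimately show ?thesis by blast
qed

section \<open>Convex hulls in lifted coordinates\<close>

text \<open>Coefficients are indexed by \<open>I\<close> rather than by points, so \<open>x\<close>
  may repeat points; the last coordinate encodes that they sum to \<open>1\<close>. Such
  combinations form a convex set containing every \<open>x k\<close>, hence containing the
  hull.\<close>

lemma convex_hull_image_lift:
  fixes x :: "'i \<Rightarrow> 'a::real_vector"
  assumes fin: "finite I"
  shows "p \<in> convex hull (x ` I) \<longleftrightarrow>
    (\<exists>\<alpha>. (\<forall>j\<in>I. 0 \<le> \<alpha> j) \<and> (p, 1::real) = (\<Sum>j\<in>I. \<alpha> j *\<^sub>R (x j, 1)))"
  (is "_ \<longleftrightarrow> ?P p")
proof
  have P_iff: "?P p \<longleftrightarrow> (\<exists>\<alpha>. (\<forall>j\<in>I. 0 \<le> \<alpha> j) \<and> sum \<alpha> I = 1 \<and> (\<Sum>j\<in>I. \<alpha> j *\<^sub>R x j) = p)" for p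
    by (auto simp: prod_eq_iff fst_sum snd_sum)
  {
    assume "?P p"
    then obtain \<alpha> where \<alpha>: "\<forall>j\<in>I. 0 \<le> \<alpha> j" "sum \<alpha> I = 1" "(\<Sum>j\<in>I. \<alpha> j *\<^sub>R x j) = p"
      unfolding P_iff by blast
    have "(\<Sum>j\<in>I. \<alpha> j *\<^sub>R x j) \<in> convex hull (x ` I)"
      using \<alpha> by (intro convex_sum fin convex_convex_hull) (auto simp: hull_inc)
    then show "p \<in> convex hull (x ` I)" using \<alpha> by simp
  next
    have "convex hull (x ` I) \<subseteq> Collect ?P"
    proof (rule hull_minimal)
      show "x ` I \<subseteq> Collect ?P"
      proof
        fix y assume "y \<in> x ` I"
        then obtain k where k: "k \<in> I" "y = x k" by blast
        have "(y, 1::real) = (\<Sum>j\<in>I. (if j = k then 1 else 0) *\<^sub>R (x j, 1))"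
          using fin k by (simp add: prod_eq_iff fst_sum snd_sum if_distrib[of "\<lambda>a. a *\<^sub>R _"] cong: if_cong)
        then show "y \<in> Collect ?P" by (intro CollectI exI[of _ "\<lambda>j. if j = k then 1 else 0"]) auto
      qed
      show "convex (Collect ?P)"
      proof (rule convexI)
        fix y z and s t :: real
        assume "y \<in> Collect ?P" "z \<in> Collect ?P" and st: "0 \<le> s" "0 \<le> t" "s + t = 1"
        then obtain \<alpha> \<beta> where \<alpha>: "\<forall>j\<in>I. 0 \<le> \<alpha> j" "(y, 1::real) = (\<Sum>j\<in>I. \<alpha> j *\<^sub>R (x j, 1))"
          and \<beta>: "\<forall>j\<in>I. 0 \<le> \<beta> j" "(z, 1::real) = (\<Sum>j\<in>I. \<beta> j *\<^sub>R (x j, 1))"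
          by blast
        have "(s *\<^sub>R y + t *\<^sub>R z, 1) = s *\<^sub>R (y, 1::real) + t *\<^sub>R (z, 1)" using st by simp
        also have "\<dots> = (\<Sum>j\<in>I. (s * \<alpha> j + t * \<beta> j) *\<^sub>R (x j, 1))"
          unfolding \<alpha> \<beta> by (simp add: scaleR_sum_right sum.distrib scaleR_add_left del: scaleR_Pair)
        finally show "s *\<^sub>R y + t *\<^sub>R z \<in> Collect ?P"
          using \<alpha>(1) \<beta>(1) st by (intro CollectI exI[of _ "\<lambda>j. s * \<alpha> j + t * \<beta> j"]) auto
      qed
    qed
    then show "p \<in> convex hull (x ` I) \<Longrightarrow> ?P p" by blast
  }
qed

section \<open>Separated families and their transversals\<close>

locale separated_bodies =
  fixes I :: "'i set" and K :: "'i \<Rightarrow> 'a::euclidean_space set"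
  assumes card_I: "card I = DIM('a) + 1"
    and nonempty: "\<And>i. i \<in> I \<Longrightarrow> K i \<noteq> {}"
    and compact: "\<And>i. i \<in> I \<Longrightarrow> compact (K i)"
    and convex: "\<And>i. i \<in> I \<Longrightarrow> convex (K i)"
    and separated: "separated_family I K"
begin

lemma finite_I: "finite I"
  using card_I card.infinite by fastforce

lemma exists_other: "\<exists>j\<in>I. j \<noteq> i"
proof (rule ccontr)
  assume "\<not> ?thesis"
  then have "I \<subseteq> {i}" by blast
  then have "card I \<le> 1" using card_mono[of "{i}" I] by simp
  then show False using card_I by simp
qed

lemma transversal_exists: obtains x where "x \<in> Pi I K"
proof -
  have "\<exists>y. y \<in> K i" if "i \<in> I" for i using nonempty[OF that] by blast
  then obtain x where "\<And>i. i \<in> I \<Longrightarrow> x i \<in> K i" by metis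
  then show ?thesis using that by blast
qed

text \<open>If \<open>w = (a, b)\<close> with \<open>a \<noteq> 0\<close>, its zero set is a
  hyperplane, of dimension \<open>d - 1 = (d + 1) - 2\<close>, meeting all \<open>d + 1\<close>
  sets, which separation excludes. If \<open>a = 0\<close>, the value at any one point gives
  \<open>b = 0\<close>.\<close>

lemma transversal_indep:
  assumes x: "x \<in> Pi I K" and w: "\<And>j. j \<in> I \<Longrightarrow> w \<bullet> (x j, 1::real) = 0"
  shows "w = 0"
proof -
  obtain a b where ab: "w = (a, b)" by (cases w)
  have ax: "a \<bullet> x j = - b" if "j \<in> I" for j
    using w[OF that] by (simp add: ab)
  have "a = 0"
  proof (rule ccontr)
    assume a: "a \<noteq> 0"
    have "affine {y. a \<bullet> y = - b}" by (rule affine_hyperplane)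
    moreover have "aff_dim {y. a \<bullet> y = - b} = int (DIM('a) + 1) - 2"
      using a by simp
    moreover have "\<forall>j\<in>I. {y. a \<bullet> y = - b} \<inter> K j \<noteq> {}" using ax x by fastforce
    moreover have "DIM('a) + 1 \<in> {2..DIM('a) + 1}" using DIM_positive[where 'a='a] by simp
    ultimately show False
      using separated card_I unfolding separated_family_def by blast
  qed
  moreover obtain i where "i \<in> I" using exists_other by blast
  ultimately show ?thesis using ax ab by (simp add: zero_prod_def)
qed

lemma transversal_expansion:
  assumes x: "x \<in> Pi I K"
  obtains \<alpha> where "z = (\<Sum>j\<in>I. \<alpha> j *\<^sub>R (x j, 1::real))"
proof (rule dual_family[of I "\<lambda>k. (x k, 1::real)"])
  show "card I = DIM('a \<times> real)" using card_I by simp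
  show "w = 0" if "\<And>i. i \<in> I \<Longrightarrow> (x i, 1::real) \<bullet> w = 0" for w
    using that by (intro transversal_indep[OF x]) (simp add: inner_commute)
  fix w assume "\<And>z. z = (\<Sum>k\<in>I. (w k \<bullet> z) *\<^sub>R (x k, 1::real))"
  then show thesis by (rule that)
qed

section \<open>Inner tangents as normal vectors\<close>

text \<open>The affine function \<open>x \<mapsto> w \<bullet> (x, 1)\<close> vanishes on the inner tangent \<open>H\<^sub>i\<close> and is
  positive on \<open>H\<^sub>i\<^sup>-\<close>.\<close>

definition inner_normal :: "'i \<Rightarrow> 'a \<times> real \<Rightarrow> bool" where
  "inner_normal i w \<longleftrightarrow>
     (\<forall>j\<in>I - {i}. has_support w (K j \<times> {1}) 0) \<and> (\<forall>y\<in>K i. 0 < w \<bullet> (y, 1))"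

text \<open>Reflecting the lifted copy of \<open>K i\<close> in the origin turns the inner tangent into a prescribed
  set of support values.\<close>

definition reflected :: "'i \<Rightarrow> 'i \<Rightarrow> ('a \<times> real) set" where
  "reflected i j = (\<lambda>p. (if j = i then - 1 else 1) *\<^sub>R p) ` (K j \<times> {1})"

lemma
  assumes "j \<in> I"
  shows reflected_nonempty: "reflected i j \<noteq> {}"
    and reflected_compact: "compact (reflected i j)"
    and reflected_convex: "convex (reflected i j)"
proof -
  have "compact (K j \<times> {1::real})" "convex (K j \<times> {1::real})"
    using compact[OF assms] convex[OF assms] by (auto intro: compact_Times convex_Times)
  then show "compact (reflected i j)" and "convex (reflected i j)"
    unfolding reflected_def by (simp_all only: compact_scaling convex_scaling)
  show "reflected i j \<noteq> {}"
    unfolding reflected_def using nonempty[OF assms] by blast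
qed

lemma reflected_indep:
  assumes x: "x \<in> Pi I (reflected i)" and w: "\<And>j. j \<in> I \<Longrightarrow> x j \<bullet> w = 0"
  shows "w = 0"
proof -
  have "\<exists>y\<in>K j. x j = (if j = i then - 1 else 1) *\<^sub>R (y, 1)" if "j \<in> I" for j
    using x that unfolding reflected_def by fastforce
  then obtain y where y: "\<And>j. j \<in> I \<Longrightarrow> y j \<in> K j"
    and xy: "\<And>j. j \<in> I \<Longrightarrow> x j = (if j = i then - 1 else 1) *\<^sub>R (y j, 1)"
    by metis
  have "w \<bullet> (y j, 1) = 0" if "j \<in> I" for j
    using w[OF that] unfolding xy[OF that] inner_scaleR_left by (simp add: inner_commute del: inner_Pair split: if_splits)
  then show ?thesis using y by (intro transversal_indep[of y]) auto
qed

text \<open>Support value \<open>- 1\<close> on the reflected \<open>K i\<close> says that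
  \<open>w\<close> is at least \<open>1\<close> on the lifted \<open>K i\<close>; support value
  \<open>0\<close> on the other bodies is tangency.\<close>

lemma inner_normal_exists:
  assumes "i \<in> I"
  shows "\<exists>w. inner_normal i w"
proof -
  have "card I = DIM('a \<times> real)" using card_I by simp
  then obtain w where w: "\<forall>j\<in>I. has_support w (reflected i j) (if j = i then - 1 else 0)"
    using support_values_surject[of I "reflected i" "\<lambda>j. if j = i then - 1 else 0"]
      reflected_nonempty reflected_compact reflected_convex reflected_indep by blast
  have "has_support w (K j \<times> {1}) 0" if "j \<in> I - {i}" for j
    using w that by (auto simp: reflected_def dest!: bspec[of _ _ j])
  moreover have "0 < w \<bullet> (y, 1)" if "y \<in> K i" for y
  proof -
    have "- (y, 1) \<in> reflected i i" 
      unfolding reflected_def using that by (intro image_eqI[of _ _ "(y, 1)"]) auto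
    then have "w \<bullet> - (y, 1) \<le> - 1"
      using bspec[OF w assms] unfolding has_support_def by simp
    then show ?thesis by (simp only: inner_minus_right)
  qed
  ultimately show ?thesis unfolding inner_normal_def by blast
qed

text \<open>Removes the scaling freedom, so that \<open>support_values_inject\<close> can compare
  two inner normals: the positive minimum of \<open>w\<close> over the lifted \<open>K i\<close> is
  rescaled to \<open>1\<close>.\<close>

lemma inner_normal_scaled_support:
  assumes i: "i \<in> I" and w: "inner_normal i w"
  obtains m where "m > 0"
    and "\<And>j. j \<in> I \<Longrightarrow> has_support (m *\<^sub>R w) (reflected i j) (if j = i then - 1 else 0)"
proof -
  obtain v where v: "has_support w (reflected i i) v"
    using has_support_exists[OF reflected_compact[OF i] reflected_nonempty[OF i]] by blast
  then obtain y where y: "y \<in> K i" "v = - (w \<bullet> (y, 1))"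
    unfolding has_support_def reflected_def by auto
  then have "v < 0" using w unfolding inner_normal_def by simp
  have "has_support ((- 1 / v) *\<^sub>R w) (reflected i j) (if j = i then - 1 else 0)" if j: "j \<in> I" for j
  proof (cases "j = i")
    case True
    then show ?thesis using has_support_scaleR[OF _ v, of "- 1 / v"] \<open>v < 0\<close> by (simp add: field_simps)
  next
    case False
    then have "has_support w (reflected i j) 0"
      using w j by (simp add: inner_normal_def reflected_def)
    then show ?thesis using has_support_scaleR[of "- 1 / v" w _ 0] False \<open>v < 0\<close> by (simp add: field_simps)
  qed
  moreover have "- 1 / v > 0" using \<open>v < 0\<close> by (simp add: field_simps)
  ultimately show ?thesis using that by blast
qed

lemma inner_normal_unique:
  assumes i: "i \<in> I" and w: "inner_normal i w" and w': "inner_normal i w'"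
  obtains m where "m > 0" "w' = m *\<^sub>R w"
proof -
  obtain m where m: "m > 0"
    "\<And>j. j \<in> I \<Longrightarrow> has_support (m *\<^sub>R w) (reflected i j) (if j = i then - 1 else 0)"
    using inner_normal_scaled_support[OF i w] by blast
  obtain m' where m': "m' > 0"
    "\<And>j. j \<in> I \<Longrightarrow> has_support (m' *\<^sub>R w') (reflected i j) (if j = i then - 1 else 0)"
    using inner_normal_scaled_support[OF i w'] by blast
  have "m *\<^sub>R w = m' *\<^sub>R w'"
    using reflected_convex reflected_indep m(2) m'(2) by (rule support_values_inject)
  then have "(1 / m') *\<^sub>R (m' *\<^sub>R w') = (1 / m') *\<^sub>R (m *\<^sub>R w)" by simp
  then have "w' = (m / m') *\<^sub>R w" using m'(1) by simp
  then show ?thesis using that[of "m / m'"] m(1) m'(1) by simp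
qed

text \<open>Weak separation becomes strict on \<open>K i\<close>: a point of \<open>K i\<close> on
  the hyperplane would complete the touching points to a transversal on which
  \<open>(- a, b)\<close> vanishes.\<close>

lemma inner_normal_of_hyperplane:
  assumes i: "i \<in> I" and a: "a \<noteq> 0"
    and touch: "\<And>j. j \<in> I - {i} \<Longrightarrow> {x. a \<bullet> x = b} \<inter> K j \<noteq> {}"
    and Ki: "K i \<subseteq> {x. a \<bullet> x \<le> b}"
    and Kj: "\<And>j. j \<in> I - {i} \<Longrightarrow> K j \<subseteq> {x. a \<bullet> x \<ge> b}"
  shows "inner_normal i (- a, b)"
proof -
  have "has_support (- a, b) (K j \<times> {1}) 0" if "j \<in> I - {i}" for j
    using touch[OF that] Kj[OF that] unfolding has_support_def by fastforce
  moreover have "0 < (- a, b) \<bullet> (y, 1)" if y: "y \<in> K i" for y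
  proof (rule ccontr)
    assume "\<not> ?thesis"
    then have ay: "a \<bullet> y = b" using Ki y by force
    have "\<exists>x\<in>K j. a \<bullet> x = b" if "j \<in> I" for j
      using touch[of j] ay y that by (cases "j = i") auto
    then obtain x where x: "\<And>j. j \<in> I \<Longrightarrow> x j \<in> K j \<and> a \<bullet> x j = b" by metis
    then have "(- a, b) = 0" by (intro transversal_indep[of x]) auto
    then show False using a by (simp add: zero_prod_def)
  qed
  ultimately show ?thesis unfolding inner_normal_def by blast
qed

lemma inner_normal_fst_nonzero:
  assumes i: "i \<in> I" and w: "inner_normal i w"
  shows "fst w \<noteq> 0"
proof
  assume "fst w = 0"
  then have c: "w \<bullet> (y, 1) = snd w" for y by (simp add: inner_prod_def)
  obtain j where "j \<in> I" "j \<noteq> i" using exists_other by blast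
  then have "snd w = 0" using w c unfolding inner_normal_def has_support_def by fastforce
  moreover have "0 < snd w" using w c nonempty[OF i] unfolding inner_normal_def by fastforce
  ultimately show False by simp
qed

lemma inner_tangent_eq:
  assumes i: "i \<in> I" and w: "inner_normal i w"
  shows "inner_tangent I K i = {x. w \<bullet> (x, 1) = 0}"
  unfolding inner_tangent_def
proof (rule the_equality)
  let ?H = "{x. w \<bullet> (x, 1) = 0}"
  have a: "- fst w \<noteq> 0" using inner_normal_fst_nonzero[OF i w] by simp
  have H: "?H = {x. - fst w \<bullet> x = snd w}" by (auto simp: inner_prod_def)
  have Kj: "K j \<subseteq> {x. - fst w \<bullet> x \<ge> snd w}" if "j \<in> I - {i}" for j
    using w that unfolding inner_normal_def has_support_def by (fastforce simp: inner_prod_def)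
  have Ki: "K i \<subseteq> {x. - fst w \<bullet> x \<le> snd w}"
    using w unfolding inner_normal_def by (fastforce simp: inner_prod_def)
  show "(\<forall>j\<in>I - {i}. tangent_hyperplane ?H (K j)) \<and> hyperplane_separates ?H {K i} (K ` (I - {i}))"
  proof (intro conjI ballI)
    fix j assume j: "j \<in> I - {i}"
    have "?H \<inter> K j \<noteq> {}"
      using w j unfolding inner_normal_def has_support_def by fastforce
    moreover have "fst w \<noteq> 0" "?H = {x. fst w \<bullet> x = - snd w}" "K j \<subseteq> {x. fst w \<bullet> x \<le> - snd w}"
      using a Kj[OF j] by (auto simp: inner_prod_def)
    ultimately show "tangent_hyperplane ?H (K j)"
      unfolding tangent_hyperplane_def by blast
  next
    show "hyperplane_separates ?H {K i} (K ` (I - {i}))"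
      unfolding hyperplane_separates_def using a H Ki Kj
      by (intro exI[of _ "- fst w"] exI[of _ "snd w"]) blast
  qed
  fix H assume H: "(\<forall>j\<in>I - {i}. tangent_hyperplane H (K j)) \<and> hyperplane_separates H {K i} (K ` (I - {i}))"
  then obtain a b where ab: "a \<noteq> 0" "H = {x. a \<bullet> x = b}" "K i \<subseteq> {x. a \<bullet> x \<le> b}"
    and "\<Union> (K ` (I - {i})) \<subseteq> {x. a \<bullet> x \<ge> b}"
    unfolding hyperplane_separates_def by auto
  then have Kj: "K j \<subseteq> {x. a \<bullet> x \<ge> b}" if "j \<in> I - {i}" for j
    using that by blast
  \<comment> \<open>A competing hyperplane yields another inner normal, hence a positive multiple of
    \<open>w\<close> with the same zero set.\<close>
  have "inner_normal i (- a, b)"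
    using H ab(2) by (intro inner_normal_of_hyperplane i ab(1,3) Kj) (auto simp: tangent_hyperplane_def)
  then obtain m where "m > 0" "(- a, b) = m *\<^sub>R w" using inner_normal_unique[OF i w] by blast
  then have "w \<bullet> (x, 1) = 0 \<longleftrightarrow> (- a, b) \<bullet> (x, 1) = 0" for x
    by (simp del: inner_Pair)
  then show "H = ?H" unfolding ab(2) by auto
qed

lemma inner_halfspace_eq:
  assumes i: "i \<in> I" and w: "inner_normal i w"
  shows "inner_halfspace I K i = {x. 0 < w \<bullet> (x, 1)}"
  unfolding inner_halfspace_def inner_tangent_eq[OF assms]
proof (rule the_equality)
  have hull: "family_hull (K ` (I - {i})) \<subseteq> {x. - fst w \<bullet> x \<ge> snd w}"
    unfolding family_hull_def
  proof (rule hull_minimal)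
    show "\<Union> (K ` (I - {i})) \<subseteq> {x. - fst w \<bullet> x \<ge> snd w}"
      using w unfolding inner_normal_def has_support_def by (fastforce simp: inner_prod_def)
  qed (rule convex_halfspace_ge)
  have "K i \<subseteq> {x. 0 < w \<bullet> (x, 1)}" using w unfolding inner_normal_def by blast
  moreover have "{x. 0 < w \<bullet> (x, 1)} = {x. - fst w \<bullet> x < snd w}"
    "{x. w \<bullet> (x, 1) = 0} = {x. - fst w \<bullet> x = snd w}"
    by (auto simp: inner_prod_def)
  moreover have "- fst w \<noteq> 0" using inner_normal_fst_nonzero[OF assms] by simp
  ultimately show "\<exists>a b. a \<noteq> 0 \<and> {x. w \<bullet> (x, 1) = 0} = {x. a \<bullet> x = b} \<and>
      {x. 0 < w \<bullet> (x, 1)} = {x. a \<bullet> x < b} \<and> K i \<subseteq> {x. 0 < w \<bullet> (x, 1)} \<and>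
      family_hull (K ` (I - {i})) \<subseteq> {x. a \<bullet> x \<ge> b}"
    using hull by (intro exI[of _ "- fst w"] exI[of _ "snd w"]) blast
next
  fix S assume "\<exists>a b. a \<noteq> 0 \<and> {x. w \<bullet> (x, 1) = 0} = {x. a \<bullet> x = b} \<and> S = {x. a \<bullet> x < b} \<and>
        K i \<subseteq> S \<and> family_hull (K ` (I - {i})) \<subseteq> {x. a \<bullet> x \<ge> b}"
  then obtain a b where ab: "a \<noteq> 0" "{x. w \<bullet> (x, 1) = 0} = {x. a \<bullet> x = b}" "S = {x. a \<bullet> x < b}"
        "K i \<subseteq> S" "family_hull (K ` (I - {i})) \<subseteq> {x. a \<bullet> x \<ge> b}" by blast
  have "inner_normal i (- a, b)"
  proof (rule inner_normal_of_hyperplane[OF i ab(1)])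
    show "{x. a \<bullet> x = b} \<inter> K j \<noteq> {}" if "j \<in> I - {i}" for j
      unfolding ab(2)[symmetric]
      using w that unfolding inner_normal_def has_support_def by fastforce
    show "K i \<subseteq> {x. a \<bullet> x \<le> b}" using ab(3,4) by force
    show "K j \<subseteq> {x. a \<bullet> x \<ge> b}" if "j \<in> I - {i}" for j
    proof -
      have "K j \<subseteq> family_hull (K ` (I - {i}))"
        unfolding family_hull_def using that by (intro subset_trans[OF _ hull_subset]) blast
      then show ?thesis using ab(5) by (rule subset_trans)
    qed
  qed
  \<comment> \<open>Positivity of \<open>m\<close> fixes the side as well as the hyperplane.\<close>
  then obtain m where "m > 0" "(- a, b) = m *\<^sub>R w" using inner_normal_unique[OF i w] by blast
  then have "0 < w \<bullet> (x, 1) \<longleftrightarrow> 0 < (- a, b) \<bullet> (x, 1)" for x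
    by (simp del: inner_Pair add: zero_less_mult_iff)
  then show "S = {x. 0 < w \<bullet> (x, 1)}" unfolding ab(3) by auto
qed

end

section \<open>Points of the simplex intersection and of the hulls\<close>

context separated_bodies
begin

lemma simplex_intersection_iff:
  "p \<in> simplex_intersection I K \<longleftrightarrow> (\<forall>x\<in>Pi I K. \<exists>\<alpha>. (\<forall>j\<in>I. 0 \<le> \<alpha> j) \<and>
      (p, 1::real) = (\<Sum>j\<in>I. \<alpha> j *\<^sub>R (x j, 1)))"
  unfolding simplex_intersection_def INT_iff convex_hull_image_lift[OF finite_I] ..

lemma family_hull_nonpos:
  assumes "i \<in> I" and "\<And>j y. j \<in> I \<Longrightarrow> j \<noteq> i \<Longrightarrow> y \<in> K j \<Longrightarrow> v \<bullet> (y, 1::real) \<le> 0"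
    and "p \<in> family_hull (K ` (I - {i}))"
  shows "v \<bullet> (p, 1) \<le> 0"
proof -
  have "family_hull (K ` (I - {i})) \<subseteq> {x. fst v \<bullet> x \<le> - snd v}"
    unfolding family_hull_def
  proof (rule hull_minimal)
    show "\<Union> (K ` (I - {i})) \<subseteq> {x. fst v \<bullet> x \<le> - snd v}"
      using assms(2) by (fastforce simp: inner_prod_def)
  qed (rule convex_halfspace_le)
  then show ?thesis using assms(3) by (auto simp: inner_prod_def)
qed

lemma family_hull_compact: "compact (family_hull (K ` (I - {i})))"
  unfolding family_hull_def using finite_I compact
  by (intro compact_convex_hull compact_UN) auto

end

section \<open>The simplex cut out by a certificate\<close>

text \<open>Paired with \<open>(x, 1)\<close>, the last assumption says that the affine functions \<open>v i\<close> combine to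
  the constant \<open>1\<close>, so they are never all nonpositive.\<close>

locale tightness_certificate = separated_bodies I K
  for I :: "'i set" and K :: "'i \<Rightarrow> 'a::euclidean_space set" +
  fixes v :: "'i \<Rightarrow> 'a \<times> real" and c :: "'i \<Rightarrow> real"
  assumes off: "\<And>i j y. i \<in> I \<Longrightarrow> j \<in> I \<Longrightarrow> j \<noteq> i \<Longrightarrow> y \<in> K j \<Longrightarrow> v i \<bullet> (y, 1) \<le> 0"
    and c_nonneg: "\<And>i. i \<in> I \<Longrightarrow> 0 \<le> c i"
    and sum_cv: "(\<Sum>i\<in>I. c i *\<^sub>R v i) = (0, 1)"
begin

lemma sum_cv_lift: "(\<Sum>i\<in>I. c i * (v i \<bullet> z)) = snd z"
proof -
  have "(\<Sum>i\<in>I. c i * (v i \<bullet> z)) = (\<Sum>i\<in>I. c i *\<^sub>R v i) \<bullet> z"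
    by (simp add: inner_sum_left)
  then show ?thesis by (simp add: sum_cv inner_prod_def)
qed

lemma tight: "tight I K"
proof -
  have False if p: "p \<in> (\<Inter>i\<in>I. family_hull (K ` (I - {i})))" for p
  proof -
    have "v i \<bullet> (p, 1) \<le> 0" if i: "i \<in> I" for i
      using off[OF i] INT_D[OF p i] by (rule family_hull_nonpos[OF i])
    then have "(\<Sum>i\<in>I. c i * (v i \<bullet> (p, 1))) \<le> 0"
      using c_nonneg by (intro sum_nonpos mult_nonneg_nonpos) auto
    then show False using sum_cv_lift[of "(p, 1)"] by simp
  qed
  then show ?thesis unfolding tight_def by blast
qed

text \<open>The rows weighted by \<open>c\<close> add up to \<open>1\<close> in every column,
  because each \<open>(x j, 1)\<close> has last coordinate \<open>1\<close>. The vector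
  \<open>z\<close> is not restricted to lifted points, since \<open>vertices_exist\<close> applies
  this to kernel vectors.\<close>

lemma coordinates_nonneg:
  assumes x: "x \<in> Pi I K" and z: "z = (\<Sum>j\<in>I. \<alpha> j *\<^sub>R (x j, 1))"
    and "\<And>i. i \<in> I \<Longrightarrow> 0 \<le> v i \<bullet> z" and j: "j \<in> I"
  shows "0 \<le> \<alpha> j"
proof (rule Z_matrix_nonneg_of_positive_row_combination[OF finite_I _ c_nonneg _ _ j, where A = "\<lambda>i j. v i \<bullet> (x j, 1)"])
  show "v i \<bullet> (x j, 1) \<le> 0" if "i \<in> I" "j \<in> I" "i \<noteq> j" for i j
    using off x that by fastforce
  show "0 < (\<Sum>i\<in>I. c i * (v i \<bullet> (x j, 1)))" for j
    by (simp only: sum_cv_lift) simp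
  show "0 \<le> (\<Sum>j\<in>I. v i \<bullet> (x j, 1) * \<alpha> j)" if "i \<in> I" for i
    using assms(3)[OF that] unfolding z inner_sum_right inner_scaleR_right by (simp only: mult.commute)
qed

lemma subset_simplex_intersection:
  assumes "\<And>i. i \<in> I \<Longrightarrow> 0 \<le> v i \<bullet> (p, 1)"
  shows "p \<in> simplex_intersection I K"
  unfolding simplex_intersection_iff
proof
  fix x assume x: "x \<in> Pi I K"
  then obtain \<alpha> where \<alpha>: "(p, 1::real) = (\<Sum>j\<in>I. \<alpha> j *\<^sub>R (x j, 1))"
    by (rule transversal_expansion)
  with coordinates_nonneg[OF x \<alpha> assms]
  show "\<exists>\<alpha>. (\<forall>j\<in>I. 0 \<le> \<alpha> j) \<and> (p, 1::real) = (\<Sum>j\<in>I. \<alpha> j *\<^sub>R (x j, 1))" by blast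
qed

text \<open>At a point of \<open>K k\<close> every term but the \<open>k\<close>-th is nonpositive,
  yet the terms sum to \<open>1\<close>.\<close>

lemma c_pos:
  assumes k: "k \<in> I"
  shows "0 < c k"
proof -
  obtain y where y: "y \<in> K k" using nonempty[OF k] by blast
  have "c k \<noteq> 0"
  proof
    assume "c k = 0"
    then have "(\<Sum>i\<in>I. c i * (v i \<bullet> (y, 1))) \<le> 0"
      using c_nonneg off k y by (intro sum_nonpos) (metis mult_nonneg_nonpos mult_zero_left order_refl)
    then show False using sum_cv_lift[of "(y, 1)"] by simp
  qed
  then show ?thesis using c_nonneg[OF k] by simp
qed

text \<open>A vector killed by all \<open>v i\<close> has nonnegative coordinates in a transversal,
  and so has its negative; hence the \<open>v i\<close> form a basis. Rescaling the dual vectors to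
  last coordinate \<open>1\<close> gives the vertices, \<open>t k\<close> being opposite to the
  facet on \<open>v k = 0\<close>.\<close>

lemma vertices_exist:
  obtains t where "\<And>i k. i \<in> I \<Longrightarrow> k \<in> I \<Longrightarrow> v i \<bullet> (t k, 1) = (if i = k then 1 / c k else 0)"
    and "\<And>z. z = (\<Sum>k\<in>I. (c k * (v k \<bullet> z)) *\<^sub>R (t k, 1))"
proof -
  obtain x where x: "x \<in> Pi I K" by (rule transversal_exists)
  have indep: "w = 0" if w: "\<And>i. i \<in> I \<Longrightarrow> v i \<bullet> w = 0" for w
  proof -
    obtain \<alpha> where \<alpha>: "w = (\<Sum>j\<in>I. \<alpha> j *\<^sub>R (x j, 1))"
      using transversal_expansion[OF x] .
    have "- w = (\<Sum>j\<in>I. - \<alpha> j *\<^sub>R (x j, 1))"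
      unfolding \<alpha> by (simp only: scaleR_minus_left sum_negf)
    moreover have "0 \<le> v i \<bullet> - w" if "i \<in> I" for i using w[OF that] by simp
    ultimately have "0 \<le> - \<alpha> j" if "j \<in> I" for j
      using that by (rule coordinates_nonneg[OF x])
    moreover have "0 \<le> \<alpha> j" if "j \<in> I" for j
      using coordinates_nonneg[OF x \<alpha> _ that] w by simp
    ultimately have "\<alpha> j = 0" if "j \<in> I" for j using that by force
    then show ?thesis unfolding \<alpha> by (intro sum.neutral ballI) (simp only: scaleR_zero_left)
  qed
  have card: "card I = DIM('a \<times> real)" using card_I by simp
  show ?thesis
  proof (rule dual_family[OF card indep])
    fix w assume w: "\<And>i k. i \<in> I \<Longrightarrow> k \<in> I \<Longrightarrow> v i \<bullet> w k = (if i = k then 1 else 0)"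
      and exp: "\<And>z. z = (\<Sum>k\<in>I. (v k \<bullet> z) *\<^sub>R w k)"
    define t where "t k = (1 / c k) *\<^sub>R fst (w k)" for k
    have wt: "w k = c k *\<^sub>R (t k, 1)" if k: "k \<in> I" for k
    proof -
      \<comment> \<open>Evaluating the combination that equals \<open>(0, 1)\<close> at
        \<open>w k\<close> leaves the single term \<open>c k\<close>.\<close>
      have "snd (w k) = (\<Sum>i\<in>I. if i = k then c i else 0)"
        unfolding sum_cv_lift[symmetric] by (rule sum.cong) (use w k in auto)
      then have "snd (w k) = c k" using finite_I k by simp
      then show ?thesis using c_pos[OF k] by (simp add: t_def prod_eq_iff)
    qed
    show ?thesis
    proof (rule that[of t])
      show "v i \<bullet> (t k, 1) = (if i = k then 1 / c k else 0)" if "i \<in> I" "k \<in> I" for i k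
        using w[OF that] c_pos[OF that(2)] unfolding wt[OF that(2)] inner_scaleR_right
        by (auto simp: field_simps simp del: inner_Pair split: if_splits)
      show "z = (\<Sum>k\<in>I. (c k * (v k \<bullet> z)) *\<^sub>R (t k, 1))" for z
      proof -
        have "z = (\<Sum>k\<in>I. (v k \<bullet> z) *\<^sub>R w k)" by (rule exp)
        also have "\<dots> = (\<Sum>k\<in>I. (c k * (v k \<bullet> z)) *\<^sub>R (t k, 1))"
          by (rule sum.cong) (simp_all only: wt scaleR_scaleR mult.commute)
        finally show ?thesis .
      qed
    qed
  qed
qed

text \<open>The barycentric coordinates of \<open>p\<close> with respect to the \<open>t k\<close>
  are \<open>c k * (v k \<bullet> (p, 1))\<close>, so they have the signs of the values of the
  \<open>v k\<close>.\<close>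

lemma simplex_halfspaces:
  obtains T where "int DIM('a) simplex T"
    and "T = {p. \<forall>i\<in>I. 0 \<le> v i \<bullet> (p, 1)}"
    and "rel_interior T = {p. \<forall>i\<in>I. 0 < v i \<bullet> (p, 1)}"
proof -
  obtain t where vt: "\<And>i k. i \<in> I \<Longrightarrow> k \<in> I \<Longrightarrow> v i \<bullet> (t k, 1) = (if i = k then 1 / c k else 0)"
    and exp: "\<And>z. z = (\<Sum>k\<in>I. (c k * (v k \<bullet> z)) *\<^sub>R (t k, 1))"
    using vertices_exist by blast
  have coord: "v k \<bullet> (\<Sum>j\<in>I. \<alpha> j *\<^sub>R (t j, 1)) = \<alpha> k / c k" if k: "k \<in> I" for \<alpha> k
  proof -
    have "v k \<bullet> (\<Sum>j\<in>I. \<alpha> j *\<^sub>R (t j, 1)) = (\<Sum>j\<in>I. if j = k then \<alpha> j / c j else 0)"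
      unfolding inner_sum_right inner_scaleR_right by (rule sum.cong) (use vt k in auto)
    then show ?thesis using finite_I k by simp
  qed
  have inj: "inj_on t I"
  proof (rule inj_onI)
    fix i k assume ik: "i \<in> I" "k \<in> I" "t i = t k"
    show "i = k"
    proof (rule ccontr)
      assume "i \<noteq> k"
      then have "v i \<bullet> (t i, 1) = 0" using vt[OF ik(1,2)] ik(3) by simp
      then show False using vt[OF ik(1,1)] c_pos[OF ik(1)] by simp
    qed
  qed
  have indep: "\<not> affine_dependent (t ` I)"
  proof
    assume "affine_dependent (t ` I)"
    then obtain U k where U: "sum U (t ` I) = 0" "(\<Sum>y\<in>t ` I. U y *\<^sub>R y) = 0"
      and k: "k \<in> I" "U (t k) \<noteq> 0"
      using affine_dependent_explicit_finite[of "t ` I"] finite_I by blast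
    have "(\<Sum>j\<in>I. U (t j) *\<^sub>R (t j, 1::real)) = 0"
      using U by (simp add: prod_eq_iff fst_sum snd_sum sum.reindex[OF inj])
    then show False using coord[OF k(1), of "\<lambda>j. U (t j)"] k c_pos[OF k(1)] by simp
  qed
  let ?T = "convex hull (t ` I)"
  have "?T = {p. \<forall>i\<in>I. 0 \<le> v i \<bullet> (p, 1)}"
  proof (intro set_eqI iffI CollectI ballI)
    fix p i assume "p \<in> ?T" and i: "i \<in> I"
    then obtain \<alpha> where \<alpha>: "\<forall>j\<in>I. 0 \<le> \<alpha> j" "(p, 1::real) = (\<Sum>j\<in>I. \<alpha> j *\<^sub>R (t j, 1))"
      using convex_hull_image_lift[OF finite_I] by blast
    then show "0 \<le> v i \<bullet> (p, 1)" unfolding \<alpha>(2) coord[OF i] using i c_pos[OF i] by simp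
  next
    fix p assume "p \<in> {p. \<forall>i\<in>I. 0 \<le> v i \<bullet> (p, 1)}"
    then show "p \<in> ?T"
      unfolding convex_hull_image_lift[OF finite_I]
      by (intro exI[of _ "\<lambda>k. c k * (v k \<bullet> (p, 1))"] conjI ballI mult_nonneg_nonneg c_nonneg exp) auto
  qed
  moreover have "rel_interior ?T = {p. \<forall>i\<in>I. 0 < v i \<bullet> (p, 1)}"
    unfolding rel_interior_convex_hull_explicit[OF indep]
  proof (intro set_eqI iffI; clarify)
    fix i U assume U: "\<forall>x\<in>t ` I. 0 < U x" "sum U (t ` I) = (1::real)" and i: "i \<in> I"
    have "(\<Sum>x\<in>t ` I. U x *\<^sub>R x, 1) = (\<Sum>j\<in>I. U (t j) *\<^sub>R (t j, 1::real))"
      using U(2) by (simp add: prod_eq_iff fst_sum snd_sum sum.reindex[OF inj])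
    then show "0 < v i \<bullet> (\<Sum>x\<in>t ` I. U x *\<^sub>R x, 1)"
      using coord[OF i, of "\<lambda>j. U (t j)"] U(1) i c_pos[OF i] by simp
  next
    fix p assume p: "\<forall>i\<in>I. 0 < v i \<bullet> (p, 1)"
    \<comment> \<open>The description of the relative interior weights points rather than indices,
      so the coordinates are transported along \<open>t\<close>.\<close>
    define U where "U y = (let k = inv_into I t y in c k * (v k \<bullet> (p, 1)))" for y
    have U: "U (t k) = c k * (v k \<bullet> (p, 1))" if "k \<in> I" for k
      using inj that by (simp add: U_def)
    have "(p, 1::real) = (\<Sum>k\<in>I. (c k * (v k \<bullet> (p, 1))) *\<^sub>R (t k, 1))" by (rule exp)
    also have "\<dots> = (\<Sum>k\<in>I. U (t k) *\<^sub>R (t k, 1))"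
      by (rule sum.cong) (simp_all only: U)
    finally have "sum U (t ` I) = 1" "(\<Sum>y\<in>t ` I. U y *\<^sub>R y) = p"
      by (simp_all add: prod_eq_iff fst_sum snd_sum sum.reindex[OF inj])
    moreover have "\<forall>y\<in>t ` I. 0 < U y" using U c_pos p by simp
    ultimately show "\<exists>U. (\<forall>x\<in>t ` I. 0 < U x) \<and> sum U (t ` I) = 1 \<and> (\<Sum>x\<in>t ` I. U x *\<^sub>R x) = p"
      by blast
  qed
  moreover have "int DIM('a) simplex ?T"
    unfolding simplex_def using indep card_image[OF inj] card_I by (intro exI[of _ "t ` I"]) simp
  ultimately show ?thesis by (rule that[rotated])
qed

lemma interior_point:
  obtains q where "\<And>i. i \<in> I \<Longrightarrow> 0 < v i \<bullet> (q, 1)"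
proof -
  obtain T where T: "int DIM('a) simplex T" "rel_interior T = {p. \<forall>i\<in>I. 0 < v i \<bullet> (p, 1)}"
    using simplex_halfspaces by blast
  have "convex T" using T(1) by (rule convex_simplex)
  moreover have "T \<noteq> {}" using T(1) by (auto simp: simplex_def)
  ultimately have "rel_interior T \<noteq> {}" by (simp add: rel_interior_eq_empty)
  then show ?thesis using T(2) that by blast
qed

end

section \<open>Inner tangents, \<open>Delta\<close> and tightness\<close>

locale inner_tangent_normals = separated_bodies I K
  for I :: "'i set" and K :: "'i \<Rightarrow> 'a::euclidean_space set" +
  fixes u :: "'i \<Rightarrow> 'a \<times> real"
  assumes normal: "\<And>i. i \<in> I \<Longrightarrow> inner_normal i (u i)"
begin

lemma normal_off:
  assumes "i \<in> I" "j \<in> I" "j \<noteq> i" "y \<in> K j"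
  shows "u i \<bullet> (y, 1) \<le> 0"
  using normal[OF assms(1)] assms(2-) unfolding inner_normal_def has_support_def by blast

lemma normal_diag:
  assumes "i \<in> I" "y \<in> K i"
  shows "0 < u i \<bullet> (y, 1)"
  using normal[OF assms(1)] assms(2) unfolding inner_normal_def by blast

text \<open>On such a transversal \<open>u i\<close> vanishes at every point but the
  \<open>i\<close>-th, so it reads off the \<open>i\<close>-th coordinate up to a positive
  factor.\<close>

lemma touching_transversal:
  assumes i: "i \<in> I"
  obtains x where "x \<in> Pi I K" "\<And>j. j \<in> I \<Longrightarrow> j \<noteq> i \<Longrightarrow> u i \<bullet> (x j, 1) = 0"
proof -
  have "\<exists>y\<in>K j. j \<noteq> i \<longrightarrow> u i \<bullet> (y, 1) = 0" if j: "j \<in> I" for j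
  proof (cases "j = i")
    case True
    then show ?thesis using nonempty[OF i] by blast
  next
    case False
    then have "has_support (u i) (K j \<times> {1}) 0"
      using normal[OF i] j unfolding inner_normal_def by blast
    then show ?thesis unfolding has_support_def by blast
  qed
  then obtain x where "\<And>j. j \<in> I \<Longrightarrow> x j \<in> K j \<and> (j \<noteq> i \<longrightarrow> u i \<bullet> (x j, 1) = 0)" by metis
  then show ?thesis using that[of x] by blast
qed

lemma touching_coordinate:
  assumes i: "i \<in> I" and x: "\<And>j. j \<in> I \<Longrightarrow> j \<noteq> i \<Longrightarrow> u i \<bullet> (x j, 1) = 0"
  shows "u i \<bullet> (\<Sum>j\<in>I. \<alpha> j *\<^sub>R (x j, 1)) = \<alpha> i * (u i \<bullet> (x i, 1))"
proof -
  have "u i \<bullet> (\<Sum>j\<in>I. \<alpha> j *\<^sub>R (x j, 1)) = (\<Sum>j\<in>I. if j = i then \<alpha> j * (u i \<bullet> (x j, 1)) else 0)"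
    unfolding inner_sum_right inner_scaleR_right by (rule sum.cong) (use x in auto)
  then show ?thesis using finite_I i by simp
qed

lemma simplex_intersection_nonneg:
  assumes p: "p \<in> simplex_intersection I K" and i: "i \<in> I"
  shows "0 \<le> u i \<bullet> (p, 1)"
proof -
  obtain x where x: "x \<in> Pi I K" "\<And>j. j \<in> I \<Longrightarrow> j \<noteq> i \<Longrightarrow> u i \<bullet> (x j, 1) = 0"
    using touching_transversal[OF i] by blast
  obtain \<alpha> where \<alpha>: "\<forall>j\<in>I. 0 \<le> \<alpha> j" "(p, 1::real) = (\<Sum>j\<in>I. \<alpha> j *\<^sub>R (x j, 1))"
    using p x(1) unfolding simplex_intersection_iff by blast
  have "0 \<le> \<alpha> i * (u i \<bullet> (x i, 1))"
    using \<alpha>(1) i x(1) by (intro mult_nonneg_nonneg less_imp_le[OF normal_diag[OF i]]) auto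
  also have "\<dots> = u i \<bullet> (p, 1)"
    unfolding \<alpha>(2) by (rule touching_coordinate[OF i x(2), symmetric])
  finally show ?thesis .
qed

lemma Delta_eq: "Delta I K = {x. \<forall>i\<in>I. 0 < u i \<bullet> (x, 1)}"
  unfolding Delta_def using inner_halfspace_eq[OF _ normal] by auto

lemma open_Delta: "open (Delta I K)"
proof -
  have "{x. 0 < u i \<bullet> (x, 1)} = {x. fst (u i) \<bullet> x > - snd (u i)}" for i
    by (auto simp: inner_prod_def)
  then have "open {x. 0 < u i \<bullet> (x, 1)}" for i by (simp add: open_halfspace_gt)
  then show ?thesis
    unfolding Delta_def using finite_I inner_halfspace_eq[OF _ normal] by (intro open_INT) auto
qed

lemma interior_simplex_intersection_subset:
  "interior (simplex_intersection I K) \<subseteq> Delta I K"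
proof
  fix q assume q: "q \<in> interior (simplex_intersection I K)"
  have "0 < u i \<bullet> (q, 1)" if i: "i \<in> I" for i
  proof -
    have "simplex_intersection I K \<subseteq> {x. fst (u i) \<bullet> x \<ge> - snd (u i)}"
      using simplex_intersection_nonneg[OF _ i] by (fastforce simp: inner_prod_def)
    then have "q \<in> interior {x. fst (u i) \<bullet> x \<ge> - snd (u i)}"
      using q interior_mono by blast
    then show ?thesis
      using inner_normal_fst_nonzero[OF i normal[OF i]] by (simp add: inner_prod_def)
  qed
  then show "q \<in> Delta I K" unfolding Delta_eq by blast
qed

lemma loose_point_nonpos:
  assumes p: "p \<in> (\<Inter>i\<in>I. family_hull (K ` (I - {i})))" and i: "i \<in> I"
  shows "u i \<bullet> (p, 1) \<le> 0"
  using normal_off[OF i] INT_D[OF p i] by (rule family_hull_nonpos[OF i])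

lemma tight_imp_point:
  assumes "tight I K"
  obtains q where "q \<in> simplex_intersection I K" "q \<in> Delta I K"
proof -
  have ne: "family_hull (K ` (I - {i})) \<noteq> {}" for i
    using exists_other[of i] nonempty unfolding family_hull_def by auto
  obtain v where v: "\<forall>i\<in>I. \<forall>y\<in>family_hull (K ` (I - {i})). v i \<bullet> (y, 1::real) \<le> 0"
    and sum_v: "(\<Sum>i\<in>I. v i) = (0, 1)"
    using empty_Inter_certificate[of I "\<lambda>i. family_hull (K ` (I - {i}))"]
      finite_I family_hull_compact ne assms
    unfolding tight_def by (auto simp: family_hull_def)
  \<comment> \<open>The weights are already absorbed into the functions \<open>v i\<close>, so they
    are all \<open>1\<close>.\<close>
  interpret V: tightness_certificate I K v "\<lambda>_. 1"
  proof
    show "v i \<bullet> (y, 1) \<le> 0" if "i \<in> I" "j \<in> I" "j \<noteq> i" "y \<in> K j" for i j y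
    proof -
      have "y \<in> family_hull (K ` (I - {i}))"
        unfolding family_hull_def using that by (intro hull_inc) blast
      then show ?thesis using v that(1) by blast
    qed
  qed (use sum_v in auto)
  obtain q where q: "\<And>i. i \<in> I \<Longrightarrow> 0 < v i \<bullet> (q, 1)" using V.interior_point by blast
  have "0 < u i \<bullet> (q, 1)" if i: "i \<in> I" for i
  proof -
    obtain x where x: "x \<in> Pi I K" "\<And>j. j \<in> I \<Longrightarrow> j \<noteq> i \<Longrightarrow> u i \<bullet> (x j, 1) = 0"
      using touching_transversal[OF i] by blast
    obtain \<alpha> where \<alpha>: "(q, 1::real) = (\<Sum>j\<in>I. \<alpha> j *\<^sub>R (x j, 1))"
      using transversal_expansion[OF x(1)] .
    have \<alpha>0: "0 \<le> \<alpha> j" if "j \<in> I" for j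
      using V.coordinates_nonneg[OF x(1) \<alpha> less_imp_le[OF q] that] .
    \<comment> \<open>Without the \<open>i\<close>-th term, \<open>v i\<close> would take at
      \<open>q\<close> a nonnegative combination of its nonpositive off-diagonal values.\<close>
    have "\<alpha> i \<noteq> 0"
    proof
      assume "\<alpha> i = 0"
      have "v i \<bullet> (q, 1) = (\<Sum>j\<in>I. \<alpha> j * (v i \<bullet> (x j, 1)))"
        unfolding \<alpha> inner_sum_right inner_scaleR_right ..
      also have "\<dots> \<le> 0"
      proof (rule sum_nonpos)
        fix j assume j: "j \<in> I"
        show "\<alpha> j * (v i \<bullet> (x j, 1)) \<le> 0"
        proof (cases "j = i")
          case True
          then show ?thesis using \<open>\<alpha> i = 0\<close> by simp
        next
          case False
          then have "v i \<bullet> (x j, 1) \<le> 0" using V.off[OF i j] x(1) j by blast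
          then show ?thesis using \<alpha>0[OF j] by (simp add: mult_nonneg_nonpos)
        qed
      qed
      finally show False using q[OF i] by simp
    qed
    then have "0 < \<alpha> i * (u i \<bullet> (x i, 1))"
      using \<alpha>0[OF i] normal_diag[OF i] x(1) i by (intro mult_pos_pos) auto
    also have "\<dots> = u i \<bullet> (q, 1)"
      unfolding \<alpha> by (rule touching_coordinate[OF i x(2), symmetric])
    finally show ?thesis .
  qed
  moreover have "q \<in> simplex_intersection I K"
    using less_imp_le[OF q] by (rule V.subset_simplex_intersection)
  ultimately show ?thesis using that unfolding Delta_eq by blast
qed

text \<open>Here the M-matrix property comes from a point instead of weights: \<open>q\<close> has
  nonnegative coordinates in the simplex of \<open>x\<close>, and the matrix sends them to the
  positive values \<open>u i \<bullet> (q, 1)\<close>.\<close>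

lemma coordinates_nonpos:
  assumes q: "q \<in> simplex_intersection I K" "q \<in> Delta I K"
    and x: "x \<in> Pi I K" and z: "z = (\<Sum>j\<in>I. \<mu> j *\<^sub>R (x j, 1))"
    and "\<And>i. i \<in> I \<Longrightarrow> u i \<bullet> z \<le> 0" and j: "j \<in> I"
  shows "\<mu> j \<le> 0"
proof -
  obtain \<alpha> where \<alpha>: "\<forall>j\<in>I. 0 \<le> \<alpha> j" "(q, 1::real) = (\<Sum>j\<in>I. \<alpha> j *\<^sub>R (x j, 1))"
    using q(1) x unfolding simplex_intersection_iff by blast
  have swap: "(\<Sum>j\<in>I. (u i \<bullet> (x j, 1)) * \<beta> j) = u i \<bullet> (\<Sum>j\<in>I. \<beta> j *\<^sub>R (x j, 1))" for i \<beta>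
    unfolding inner_sum_right inner_scaleR_right by (simp only: mult.commute)
  show ?thesis
  proof (rule Z_matrix_nonpos_of_positive_image[OF finite_I _ _ _ _ _ j, where A = "\<lambda>i j. u i \<bullet> (x j, 1)" and \<alpha> = \<alpha>])
    show "u i \<bullet> (x j, 1) \<le> 0" if "i \<in> I" "j \<in> I" "i \<noteq> j" for i j
      using normal_off[OF that(1,2)] that x by blast
    show "0 < u i \<bullet> (x i, 1)" if "i \<in> I" for i
      using normal_diag[OF that] x that by blast
    show "0 \<le> \<alpha> i" if "i \<in> I" for i using \<alpha>(1) that by blast
    show "0 < (\<Sum>j\<in>I. u i \<bullet> (x j, 1) * \<alpha> j)" if "i \<in> I" for i
      unfolding swap \<alpha>(2)[symmetric] using q(2) that unfolding Delta_eq by blast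
    show "(\<Sum>j\<in>I. u i \<bullet> (x j, 1) * \<mu> j) \<le> 0" if "i \<in> I" for i
      unfolding swap z[symmetric] by (rule assms(5)[OF that])
  qed
qed

text \<open>The \<open>u i\<close> form a basis, so the weights are forced as the coefficients of
  \<open>(0, 1)\<close>; what remains is their sign.\<close>

lemma point_imp_certificate:
  assumes q: "q \<in> simplex_intersection I K" "q \<in> Delta I K"
  obtains c where "tightness_certificate I K u c"
proof -
  obtain x where x: "x \<in> Pi I K" by (rule transversal_exists)
  have card: "card I = DIM('a \<times> real)" using card_I by simp
  have indep: "w = 0" if w: "\<And>i. i \<in> I \<Longrightarrow> u i \<bullet> w = 0" for w
  proof -
    obtain \<mu> where \<mu>: "w = (\<Sum>j\<in>I. \<mu> j *\<^sub>R (x j, 1))"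
      using transversal_expansion[OF x] .
    have "- w = (\<Sum>j\<in>I. - \<mu> j *\<^sub>R (x j, 1))"
      unfolding \<mu> by (simp only: scaleR_minus_left sum_negf)
    moreover have "u i \<bullet> - w \<le> 0" if "i \<in> I" for i using w[OF that] by simp
    ultimately have "- \<mu> j \<le> 0" if "j \<in> I" for j
      using that by (rule coordinates_nonpos[OF q x])
    moreover have "u i \<bullet> w \<le> 0" if "i \<in> I" for i using w[OF that] by simp
    with \<mu> have "\<mu> j \<le> 0" if "j \<in> I" for j
      using that by (rule coordinates_nonpos[OF q x])
    ultimately have "\<mu> j = 0" if "j \<in> I" for j using that by force
    then show ?thesis unfolding \<mu> by (intro sum.neutral ballI) (simp only: scaleR_zero_left)
  qed
  show ?thesis
  proof (rule dual_family[OF card indep])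
    fix w assume w: "\<And>i k. i \<in> I \<Longrightarrow> k \<in> I \<Longrightarrow> u i \<bullet> w k = (if i = k then 1 else 0)"
      and exp: "\<And>z. z = (\<Sum>k\<in>I. (w k \<bullet> z) *\<^sub>R u k)"
    have "tightness_certificate I K u (\<lambda>k. w k \<bullet> (0, 1))"
    proof
      show "u i \<bullet> (y, 1) \<le> 0" if "i \<in> I" "j \<in> I" "j \<noteq> i" "y \<in> K j" for i j y
        using that by (rule normal_off)
      show "(\<Sum>k\<in>I. (w k \<bullet> (0, 1)) *\<^sub>R u k) = (0, 1)" by (rule exp[symmetric])
      show "0 \<le> w k \<bullet> (0, 1)" if k: "k \<in> I" for k
      proof -
        \<comment> \<open>All \<open>u i\<close> are nonpositive on \<open>- w k\<close>, so its
          coordinates are nonpositive; their sum is its last coordinate, the negative of the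
          \<open>k\<close>-th weight.\<close>
        obtain \<mu> where \<mu>: "- w k = (\<Sum>j\<in>I. \<mu> j *\<^sub>R (x j, 1))"
          using transversal_expansion[OF x] .
        moreover have "u i \<bullet> - w k \<le> 0" if "i \<in> I" for i using w[OF that k] by simp
        ultimately have "\<mu> j \<le> 0" if "j \<in> I" for j
          using that by (rule coordinates_nonpos[OF q x])
        then have "sum \<mu> I \<le> 0" by (rule sum_nonpos)
        moreover have "snd (- w k) = sum \<mu> I" unfolding \<mu> by (simp add: snd_sum)
        ultimately show ?thesis by (simp add: inner_prod_def)
      qed
    qed
    then show ?thesis by (rule that)
  qed
qed

text \<open>At a common point \<open>p\<close> of the hulls every \<open>u i\<close> is nonpositive,
  while it is positive at a point \<open>q\<close> of \<open>Delta\<close>. So it grows along the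
  ray from \<open>q\<close> away from \<open>p\<close>, and the whole ray stays in
  \<open>Delta\<close>.\<close>

lemma bounded_Delta_imp_tight:
  assumes ne: "Delta I K \<noteq> {}" and bdd: "bounded (Delta I K)"
  shows "tight I K"
proof -
  have False if p: "p \<in> (\<Inter>i\<in>I. family_hull (K ` (I - {i})))" for p
  proof -
    obtain q where q: "q \<in> Delta I K" using ne by blast
    obtain B where B: "\<And>y. y \<in> Delta I K \<Longrightarrow> norm y \<le> B" using bdd unfolding bounded_iff by blast
    have ray: "q + t *\<^sub>R (q - p) \<in> Delta I K" if t: "0 \<le> t" for t
      unfolding Delta_eq
    proof (intro CollectI ballI)
      fix i assume i: "i \<in> I"
      have "0 < u i \<bullet> (q, 1)" using q i unfolding Delta_eq by blast
      moreover have "0 \<le> t * (u i \<bullet> (q, 1) - u i \<bullet> (p, 1))"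
        using t calculation loose_point_nonpos[OF p i] by (intro mult_nonneg_nonneg) auto
      moreover have "u i \<bullet> (q + t *\<^sub>R (q - p), 1) = u i \<bullet> (q, 1) + t * (u i \<bullet> (q, 1) - u i \<bullet> (p, 1))"
        by (simp add: inner_prod_def inner_add_right inner_diff_right algebra_simps)
      ultimately show "0 < u i \<bullet> (q + t *\<^sub>R (q - p), 1)" by linarith
    qed
    obtain i where i: "i \<in> I" using exists_other by blast
    have "q \<noteq> p" using q loose_point_nonpos[OF p i] i unfolding Delta_eq by force
    then have d: "0 < norm (q - p)" by simp
    have B0: "norm q \<le> B" using B q by blast
    then have "0 \<le> B" using norm_ge_zero order_trans by blast
    \<comment> \<open>Puts the point of the ray at distance at least \<open>B + 1\<close> from the
      origin.\<close>
    define t where "t = (B + norm q + 1) / norm (q - p)"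
    have t: "0 \<le> t" unfolding t_def using d \<open>0 \<le> B\<close> by simp
    have "norm (t *\<^sub>R (q - p)) = B + norm q + 1" using d \<open>0 \<le> B\<close> unfolding t_def by simp
    moreover have "norm (t *\<^sub>R (q - p)) \<le> norm (q + t *\<^sub>R (q - p)) + norm q"
      using norm_triangle_ineq4[of "q + t *\<^sub>R (q - p)" q] by simp
    ultimately show False using B[OF ray[OF t]] by simp
  qed
  then show ?thesis unfolding tight_def by blast
qed

text \<open>With the inner normals themselves as certificate, the closed simplex lies in every
  \<open>conv(x)\<close>, and \<open>simplex_intersection_nonneg\<close> gives the reverse
  inclusion.\<close>

lemma certificate_imp_simplex:
  assumes "tightness_certificate I K u c"
  shows "Delta I K \<noteq> {}" "open_simplex (int DIM('a)) (Delta I K)"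
    "closure (Delta I K) = simplex_intersection I K"
proof -
  interpret tightness_certificate I K u c by (rule assms)
  obtain T where T: "int DIM('a) simplex T" "T = {p. \<forall>i\<in>I. 0 \<le> u i \<bullet> (p, 1)}"
    "rel_interior T = {p. \<forall>i\<in>I. 0 < u i \<bullet> (p, 1)}"
    using simplex_halfspaces by blast
  have D: "Delta I K = rel_interior T" unfolding Delta_eq T(3) ..
  obtain q where "\<And>i. i \<in> I \<Longrightarrow> 0 < u i \<bullet> (q, 1)" using interior_point by blast
  then show "Delta I K \<noteq> {}" unfolding Delta_eq by blast
  show "open_simplex (int DIM('a)) (Delta I K)"
    unfolding open_simplex_def using T(1) D by blast
  have "closure (Delta I K) = T"
    unfolding D using convex_simplex[OF T(1)] closed_simplex[OF T(1)]
    by (simp add: convex_closure_rel_interior)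
  also have "T = simplex_intersection I K"
    unfolding T(2) using subset_simplex_intersection simplex_intersection_nonneg by blast
  finally show "closure (Delta I K) = simplex_intersection I K" .
qed

end

section \<open>Equivalence of tightness with the two geometric conditions\<close>

theorem theorem2p6:
  fixes K :: "nat \<Rightarrow> 'a::euclidean_space set"
    and I :: "nat set"
  defines "I \<equiv> {1..DIM('a) + 1}"
  assumes "\<And>i. i \<in> I \<Longrightarrow> K i \<noteq> {}"
    and "\<And>i. i \<in> I \<Longrightarrow> compact (K i)"
    and "\<And>i. i \<in> I \<Longrightarrow> convex (K i)"
    and "separated_family I K"
  shows "(tight I K \<longleftrightarrow> Delta I K \<noteq> {} \<and> open_simplex (int DIM('a)) (Delta I K)) \<and>
         (tight I K \<longleftrightarrow> interior (simplex_intersection I K) \<noteq> {}) \<and>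
         (tight I K \<longrightarrow> closure (Delta I K) = simplex_intersection I K)"
proof -
  interpret separated_bodies I K
    using assms(2-) by unfold_locales (auto simp: I_def)
  obtain u where "\<And>i. i \<in> I \<Longrightarrow> inner_normal i (u i)" using inner_normal_exists by metis
  then interpret inner_tangent_normals I K u by unfold_locales
  have "tight I K" if "Delta I K \<noteq> {}" "open_simplex (int DIM('a)) (Delta I K)"
  proof -
    obtain T where T: "int DIM('a) simplex T" "Delta I K = rel_interior T"
      using \<open>open_simplex _ _\<close> unfolding open_simplex_def by blast
    \<comment> \<open>The simplex shape enters this direction through boundedness.\<close>
    have "bounded T" using compact_simplex[OF T(1)] by (rule compact_imp_bounded)
    then have "bounded (Delta I K)"
      unfolding T(2) using rel_interior_subset by (rule bounded_subset)
    then show ?thesis using that(1) by (rule bounded_Delta_imp_tight[rotated])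
  qed
  moreover have "tight I K" if ne: "interior (simplex_intersection I K) \<noteq> {}"
  proof -
    obtain q where "q \<in> interior (simplex_intersection I K)" using ne by blast
    then have "q \<in> simplex_intersection I K" "q \<in> Delta I K"
      using interior_subset interior_simplex_intersection_subset by blast+
    then obtain c where "tightness_certificate I K u c" by (rule point_imp_certificate)
    then show ?thesis by (rule tightness_certificate.tight)
  qed
  moreover have "Delta I K \<noteq> {} \<and> open_simplex (int DIM('a)) (Delta I K) \<and>
      interior (simplex_intersection I K) \<noteq> {} \<and> closure (Delta I K) = simplex_intersection I K"
    if tight: "tight I K"
  proof -
    obtain q where "q \<in> simplex_intersection I K" "q \<in> Delta I K"
      using tight by (rule tight_imp_point)
    then obtain c where "tightness_certificate I K u c" by (rule point_imp_certificate)
    note Delta = certificate_imp_simplex[OF this]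
    \<comment> \<open>\<open>Delta\<close> is open and lies in its closure, which has just been
      identified with the intersection.\<close>
    have "Delta I K \<subseteq> interior (simplex_intersection I K)"
      using open_Delta closure_subset[of "Delta I K"] unfolding Delta(3) by (intro interior_maximal)
    then show ?thesis using Delta by blast
  qed
  ultimately show ?thesis by blast
qed

end
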